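(* $\mathcal F_n$ is a free loop of rank $n$ in the variety $\mathcal E$.
   Context: In a Moufang loop, $[x,y]=x^{-1}y^{-1}xy$ and $(x,y,z)=((xy)z)(x(yz))^{-1}$. $\mathcal E$ is the variety of Moufang loops defined by the identities $x^4=1$, $[x,y]^2=1$, $(x,y,z)^2=1$, $[x^2,y]=1$, $[[x,y],t]=1$, $[(x,y,z),t]=1$, $(x^2,y,z)=1$, $([x,y],z,t)=1$, $((x,y,z),t,s)=1$. Construction of $\mathcal F$. Let $V$ be the $\mathbf F_2$-vector space of all finite subsets of $\mathbb N=\{1,2,\dots\}$, with addition the symmetric difference $\Delta$ (the basis vector with index $i$ is identified with $\{i\}$, also written $i$). Let $\bar V$, $W$, $U$ be elementary abelian $2$-groups, written multiplicatively, with bases respectively $\{\bar i : i\in\mathbb N\}$; the symbols $i\wedge j$ for unordered pairs $\{i,j\}$ with $i\ne j$; and the symbols $i\wedge j\wedge k$ for unordered triples of distinct $i,j,k$. The symbols are symmetric in their indices and are trivial (equal to $1$) if two indices coincide. As a set $\mathcal F=V\times(\bar V\times W\times U)$, with elements written $\sigma z$. For $\sigma,\mu\in V$, $$\sigma\cdot\mu=(\sigma\Delta\mu)\prod_{i\in\sigma\cap\mu}\bar i\ \prod_{i\in\sigma,\,j\in\mu,\,i>j} i\wedge j\ \prod_{i\in\sigma,\ j,k\in\mu,\ j<k} i\wedge j\wedge k ,$$ and $(\sigma z)\cdot(\mu z')=(\sigma\cdot\mu)\,z z'$ for $z,z'\in\bar V\times W\times U$. This $\mathcal F$ is a Moufang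 loop. $\mathcal F_n$ is the subloop of $\mathcal F$ generated by $\{i : i\in I_n\}$, $I_n=\{1,\dots,n\}$. *)

theory Defs
  imports "HOL-Algebra.FiniteProduct"
begin

section \<open>Moufang loops\<close>

text \<open>
  Loops are carried by the record type \<^typ>\<open>('a, 'm) monoid_scheme\<close>, so that \<^const>\<open>hom\<close>, \<^const>\<open>m_inv\<close>
  and the power operation can be reused; none of these presupposes associativity in its definition.
  The power of an element is left-normed, e.g. x^4 = ((x x) x) x. In a Moufang loop every
  element has exactly one two-sided inverse, so that \<^const>\<open>m_inv\<close> denotes it.
\<close>

locale alg_loop =
  fixes G (structure)
  assumes mult_closed: "\<lbrakk>x \<in> carrier G; y \<in> carrier G\<rbrakk> \<Longrightarrow> x \<otimes> y \<in> carrier G"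
    and unit_closed: "\<one> \<in> carrier G"
    and unit_left: "x \<in> carrier G \<Longrightarrow> \<one> \<otimes> x = x"
    and unit_right: "x \<in> carrier G \<Longrightarrow> x \<otimes> \<one> = x"
    and left_division: "\<lbrakk>a \<in> carrier G; b \<in> carrier G\<rbrakk> \<Longrightarrow> \<exists>!x. x \<in> carrier G \<and> a \<otimes> x = b"
    and right_division: "\<lbrakk>a \<in> carrier G; b \<in> carrier G\<rbrakk> \<Longrightarrow> \<exists>!y. y \<in> carrier G \<and> y \<otimes> a = b"

locale moufang_loop = alg_loop +
  assumes moufang: "\<lbrakk>x \<in> carrier G; y \<in> carrier G; z \<in> carrier G\<rbrakk>
    \<Longrightarrow> (x \<otimes> y) \<otimes> (z \<otimes> x) = (x \<otimes> (y \<otimes> z)) \<otimes> x"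

text \<open>
  The word \<open>x\<^sup>-\<^sup>1 y\<^sup>-\<^sup>1 x y\<close> needs no brackets in a Moufang loop, since any two elements generate
  a group; one bracketing is fixed here.
\<close>

definition loop_commutator :: "('a, 'm) monoid_scheme \<Rightarrow> 'a \<Rightarrow> 'a \<Rightarrow> 'a" where
  "loop_commutator G x y = (inv\<^bsub>G\<^esub> x \<otimes>\<^bsub>G\<^esub> inv\<^bsub>G\<^esub> y) \<otimes>\<^bsub>G\<^esub> (x \<otimes>\<^bsub>G\<^esub> y)"

definition loop_associator :: "('a, 'm) monoid_scheme \<Rightarrow> 'a \<Rightarrow> 'a \<Rightarrow> 'a \<Rightarrow> 'a" where
  "loop_associator G x y z =
     ((x \<otimes>\<^bsub>G\<^esub> y) \<otimes>\<^bsub>G\<^esub> z) \<otimes>\<^bsub>G\<^esub> inv\<^bsub>G\<^esub> (x \<otimes>\<^bsub>G\<^esub> (y \<otimes>\<^bsub>G\<^esub> z))"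

text \<open>Membership in the variety \<open>\<E>\<close>.\<close>

locale variety_E = moufang_loop +
  assumes pow4: "x \<in> carrier G \<Longrightarrow> x [^] (4::nat) = \<one>"
    and comm_pow2: "\<lbrakk>x \<in> carrier G; y \<in> carrier G\<rbrakk>
      \<Longrightarrow> (loop_commutator G x y) [^] (2::nat) = \<one>"
    and assoc_pow2: "\<lbrakk>x \<in> carrier G; y \<in> carrier G; z \<in> carrier G\<rbrakk>
      \<Longrightarrow> (loop_associator G x y z) [^] (2::nat) = \<one>"
    and square_comm: "\<lbrakk>x \<in> carrier G; y \<in> carrier G\<rbrakk>
      \<Longrightarrow> loop_commutator G (x [^] (2::nat)) y = \<one>"
    and comm_comm: "\<lbrakk>x \<in> carrier G; y \<in> carrier G; t \<in> carrier G\<rbrakk>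
      \<Longrightarrow> loop_commutator G (loop_commutator G x y) t = \<one>"
    and assoc_comm: "\<lbrakk>x \<in> carrier G; y \<in> carrier G; z \<in> carrier G; t \<in> carrier G\<rbrakk>
      \<Longrightarrow> loop_commutator G (loop_associator G x y z) t = \<one>"
    and square_assoc: "\<lbrakk>x \<in> carrier G; y \<in> carrier G; z \<in> carrier G\<rbrakk>
      \<Longrightarrow> loop_associator G (x [^] (2::nat)) y z = \<one>"
    and comm_assoc: "\<lbrakk>x \<in> carrier G; y \<in> carrier G; z \<in> carrier G; t \<in> carrier G\<rbrakk>
      \<Longrightarrow> loop_associator G (loop_commutator G x y) z t = \<one>"
    and assoc_assoc: "\<lbrakk>x \<in> carrier G; y \<in> carrier G; z \<in> carrier G; t \<in> carrier G; s \<in> carrier G\<rbrakk>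
      \<Longrightarrow> loop_associator G (loop_associator G x y z) t s = \<one>"

definition subloop :: "'a set \<Rightarrow> ('a, 'm) monoid_scheme \<Rightarrow> bool" where
  "subloop H G \<longleftrightarrow> H \<subseteq> carrier G \<and> alg_loop (G\<lparr>carrier := H\<rparr>)"

definition subloop_generated :: "('a, 'm) monoid_scheme \<Rightarrow> 'a set \<Rightarrow> 'a set" where
  "subloop_generated G S = \<Inter>{H. subloop H G \<and> S \<subseteq> H}"

text \<open>
  \<open>X\<close> is a set of free generators of \<open>G\<close> in \<open>\<E>\<close>. As HOL cannot quantify over types inside a
  formula, the carrier type \<^typ>\<open>'b\<close> of the test loops \<open>L\<close> is a parameter; in a theorem about
  \<open>TYPE('b)\<close> it is a free type variable and hence arbitrary. Homomorphisms are compared on the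
  carrier only.
\<close>

definition free_basis_E :: "'b itself \<Rightarrow> ('a, 'm) monoid_scheme \<Rightarrow> 'a set \<Rightarrow> bool" where
  "free_basis_E _ G X \<longleftrightarrow>
     variety_E G \<and> X \<subseteq> carrier G \<and> subloop_generated G X = carrier G \<and>
     (\<forall>(L :: 'b monoid) f. variety_E L \<longrightarrow> f \<in> X \<rightarrow> carrier L \<longrightarrow>
        (\<exists>h \<in> hom G L. (\<forall>x\<in>X. h x = f x) \<and>
           (\<forall>h' \<in> hom G L. (\<forall>x\<in>X. h' x = f x) \<longrightarrow> (\<forall>x\<in>carrier G. h' x = h x))))"

section \<open>The loop \<open>\<F>\<close>\<close>

text \<open>
  The elementary abelian 2-group with basis \<open>B\<close>: a finite subset of \<open>B\<close> stands for the product
  of its elements.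
\<close>

definition elem_ab2 :: "'b set \<Rightarrow> 'b set monoid" where
  "elem_ab2 B = \<lparr>carrier = {A. finite A \<and> A \<subseteq> B}, mult = (\<lambda>A A'. sym_diff A A'), one = {}\<rparr>"

definition V_grp :: "nat set monoid" where
  "V_grp = elem_ab2 {1..}"

text \<open>
  The symbol \<open>i \<and> j\<close> is encoded by the unordered pair \<open>{i, j}\<close>, and \<open>i \<and> j \<and> k\<close> by the unordered
  triple \<open>{i, j, k}\<close>. The following groups are \<open>V-bar\<close>, \<open>W\<close> and \<open>U\<close>.
\<close>

definition Vbar_grp :: "nat set monoid" where
  "Vbar_grp = elem_ab2 {1..}"

definition W_grp :: "nat set set monoid" where
  "W_grp = elem_ab2 {P. P \<subseteq> {1..} \<and> card P = 2}"

definition U_grp :: "nat set set monoid" where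
  "U_grp = elem_ab2 {T. T \<subseteq> {1..} \<and> card T = 3}"

type_synonym zelem = "nat set \<times> nat set set \<times> nat set set"

definition Z_grp :: "zelem monoid" where
  "Z_grp = Vbar_grp \<times>\<times> (W_grp \<times>\<times> U_grp)"

definition bar_sym :: "nat \<Rightarrow> zelem" where
  "bar_sym i = ({i}, {}, {})"

definition wedge2 :: "nat \<Rightarrow> nat \<Rightarrow> zelem" where
  "wedge2 i j = (if i = j then \<one>\<^bsub>Z_grp\<^esub> else ({}, {{i, j}}, {}))"

definition wedge3 :: "nat \<Rightarrow> nat \<Rightarrow> nat \<Rightarrow> zelem" where
  "wedge3 i j k = (if i = j \<or> i = k \<or> j = k then \<one>\<^bsub>Z_grp\<^esub> else ({}, {}, {{i, j, k}}))"

text \<open>The factor \<open>z\<close> in \<open>\<sigma> \<cdot> \<mu> = (\<sigma> \<Delta> \<mu>) z\<close>.\<close>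

definition F_factor :: "nat set \<Rightarrow> nat set \<Rightarrow> zelem" where
  "F_factor \<sigma> \<mu> =
     (\<Otimes>\<^bsub>Z_grp\<^esub>i\<in>\<sigma> \<inter> \<mu>. bar_sym i)
     \<otimes>\<^bsub>Z_grp\<^esub> (\<Otimes>\<^bsub>Z_grp\<^esub>p\<in>{(i, j). i \<in> \<sigma> \<and> j \<in> \<mu> \<and> i > j}. case p of (i, j) \<Rightarrow> wedge2 i j)
     \<otimes>\<^bsub>Z_grp\<^esub> (\<Otimes>\<^bsub>Z_grp\<^esub>p\<in>{(i, j, k). i \<in> \<sigma> \<and> j \<in> \<mu> \<and> k \<in> \<mu> \<and> j < k}.
                 case p of (i, j, k) \<Rightarrow> wedge3 i j k)"

definition F_loop :: "(nat set \<times> zelem) monoid" where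
  "F_loop = \<lparr>carrier = carrier V_grp \<times> carrier Z_grp,
     mult = (\<lambda>(\<sigma>, z) (\<mu>, z').
       (\<sigma> \<otimes>\<^bsub>V_grp\<^esub> \<mu>, F_factor \<sigma> \<mu> \<otimes>\<^bsub>Z_grp\<^esub> z \<otimes>\<^bsub>Z_grp\<^esub> z')),
     one = (\<one>\<^bsub>V_grp\<^esub>, \<one>\<^bsub>Z_grp\<^esub>)\<rparr>"

definition F_gen :: "nat \<Rightarrow> nat set \<times> zelem" where
  "F_gen i = ({i}, \<one>\<^bsub>Z_grp\<^esub>)"

definition Fn_loop :: "nat \<Rightarrow> (nat set \<times> zelem) monoid" where
  "Fn_loop n = F_loop\<lparr>carrier := subloop_generated F_loop (F_gen ` {1..n})\<rparr>"

end

theory Submission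
  imports Defs
begin

text \<open>
  In a loop of \<open>\<E>\<close> squares, commutators and associators are central. Modulo central elements the loop
  is an elementary abelian 2-group, so the associator is a map on a vector space over \<open>F\<^sub>2\<close>; the Moufang
  identity makes it symmetric and alternating, and the pentagon identity makes it trilinear. Hence
  the product of two ordered products of elements \<open>g\<^sub>i\<close> can be reordered by exactly the rule that
  defines \<open>\<F>\<close>: moving \<open>g\<^sub>k\<close> to the left past \<open>g\<^sub>m\<close> produces a commutator, and rebracketing
  \<open>P (Q g\<^sub>k)\<close> as \<open>(P Q) g\<^sub>k\<close> produces a trilinear associator term, which is also the polarization of
  the part of the cocycle of \<open>\<F>\<close> that is quadratic in its second argument. This gives a homomorphism \<open>\<F> \<rightarrow> L\<close> for every family
  \<open>(g\<^sub>i)\<close> in \<open>L \<in> \<E>\<close>. Setting \<open>g\<^sub>i = 1\<close> for \<open>i > n\<close> and restricting, existence for \<open>\<F>\<^sub>n\<close> needs no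
  explicit description of its elements.
\<close>

section \<open>Moufang loops\<close>

context alg_loop
begin

lemma left_cancel:
  assumes "a \<in> carrier G" "x \<in> carrier G" "y \<in> carrier G" "a \<otimes> x = a \<otimes> y"
  shows "x = y"
  using left_division[OF assms(1) mult_closed[OF assms(1,3)]] assms by auto

lemma right_cancel:
  assumes "a \<in> carrier G" "x \<in> carrier G" "y \<in> carrier G" "x \<otimes> a = y \<otimes> a"
  shows "x = y"
  using right_division[OF assms(1) mult_closed[OF assms(3,1)]] assms by auto

lemmas loop_simps [simp] = mult_closed unit_closed unit_left unit_right

end

context moufang_loop
begin

lemma flexible:
  assumes "x \<in> carrier G" "y \<in> carrier G"
  shows "(x \<otimes> y) \<otimes> x = x \<otimes> (y \<otimes> x)"
  using moufang[OF assms(1) unit_closed assms(2)] assms by simp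

text \<open>With \<open>x \<otimes> y = \<one>\<close> the left side of the Moufang identity
  collapses to \<open>z \<otimes> x\<close>; cancelling the right factor \<open>x\<close> gives the
  claim. Two-sided inverses and the left inverse property follow from it.\<close>

lemma inverse_cancel:
  assumes "x \<in> carrier G" "y \<in> carrier G" "x \<otimes> y = \<one>" "z \<in> carrier G"
  shows "x \<otimes> (y \<otimes> z) = z"
proof (rule right_cancel[of x])
  show "x \<otimes> (y \<otimes> z) \<otimes> x = z \<otimes> x"
    using moufang[of x y z] assms by simp
qed (use assms in auto)

lemma inverse_commute:
  assumes "x \<in> carrier G" "y \<in> carrier G" "x \<otimes> y = \<one>"
  shows "y \<otimes> x = \<one>"
  using inverse_cancel[OF assms assms(1)] left_cancel[of x "y \<otimes> x" \<one>] assms by simp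

lemma inv_eqI:
  assumes "x \<in> carrier G" "y \<in> carrier G" "x \<otimes> y = \<one>"
  shows "inv x = y"
  unfolding m_inv_def
proof (rule the_equality)
  show "y \<in> carrier G \<and> x \<otimes> y = \<one> \<and> y \<otimes> x = \<one>"
    using assms inverse_commute by blast
next
  fix z assume "z \<in> carrier G \<and> x \<otimes> z = \<one> \<and> z \<otimes> x = \<one>"
  then show "z = y"
    using left_cancel[of x z y] assms by simp
qed

lemma inv_props:
  assumes "x \<in> carrier G"
  shows loop_inv_closed [simp]: "inv x \<in> carrier G"
    and right_inv [simp]: "x \<otimes> inv x = \<one>"
    and left_inv [simp]: "inv x \<otimes> x = \<one>"
proof -
  obtain y where "y \<in> carrier G" "x \<otimes> y = \<one>"
    using left_division[OF assms unit_closed] by blast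
  then show "inv x \<in> carrier G" "x \<otimes> inv x = \<one>" "inv x \<otimes> x = \<one>"
    using inv_eqI[of x y] inverse_commute[of x y] assms by auto
qed

lemma loop_inv_inv: "x \<in> carrier G \<Longrightarrow> inv (inv x) = x"
  by (rule inv_eqI) auto

lemma left_inverse_property:
  assumes "x \<in> carrier G" "y \<in> carrier G"
  shows "x \<otimes> (inv x \<otimes> y) = y" "inv x \<otimes> (x \<otimes> y) = y"
  using inverse_cancel[of x "inv x" y] inverse_cancel[of "inv x" x y] assms by auto

lemma right_inverse_property:
  assumes "x \<in> carrier G" "y \<in> carrier G"
  shows "(y \<otimes> inv x) \<otimes> x = y" "(y \<otimes> x) \<otimes> inv x = y"
proof -
  \<comment> \<open>Flexibility moves the outer bracket, and the Moufang identity with third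
    variable \<open>inv x\<close> produces the factor \<open>inv x \<otimes> x\<close>, which
    disappears.\<close>
  have *: "(y \<otimes> inv x) \<otimes> x = y" if "x \<in> carrier G" for x
  proof (rule left_cancel[of x])
    have "x \<otimes> (y \<otimes> inv x \<otimes> x) = x \<otimes> (y \<otimes> inv x) \<otimes> x"
      using that assms by (simp add: flexible)
    also have "\<dots> = (x \<otimes> y) \<otimes> (inv x \<otimes> x)"
      using moufang[of x y "inv x"] that assms by simp
    finally show "x \<otimes> (y \<otimes> inv x \<otimes> x) = x \<otimes> y"
      using that assms by simp
  qed (use that assms in auto)
  show "(y \<otimes> inv x) \<otimes> x = y" "(y \<otimes> x) \<otimes> inv x = y"
    using *[of x] *[of "inv x"] assms by (auto simp: loop_inv_inv)
qed

lemma loop_inv_mult: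
  assumes "x \<in> carrier G" "y \<in> carrier G"
  shows "inv (x \<otimes> y) = inv y \<otimes> inv x"
proof -
  \<comment> \<open>Multiply \<open>inv x \<otimes> (x \<otimes> y) = y\<close> on the right by
    \<open>inv (x \<otimes> y)\<close> and use the right inverse property.\<close>
  have "y \<otimes> inv (x \<otimes> y) = inv x"
    using left_inverse_property(2)[of x "y \<otimes> inv (x \<otimes> y)"]
      right_inverse_property(2)[of "inv (x \<otimes> y)" "inv x"]
      right_inverse_property(2)[of "x \<otimes> y" "inv x"] left_inverse_property(2)[of x y] assms
    by simp
  then show ?thesis
    using left_inverse_property(2)[of y "inv (x \<otimes> y)"] assms by simp
qed

lemma commutator_closed [simp]:
  "\<lbrakk>x \<in> carrier G; y \<in> carrier G\<rbrakk> \<Longrightarrow> loop_commutator G x y \<in> carrier G"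
  by (simp add: loop_commutator_def)

lemma associator_closed [simp]:
  "\<lbrakk>x \<in> carrier G; y \<in> carrier G; z \<in> carrier G\<rbrakk> \<Longrightarrow> loop_associator G x y z \<in> carrier G"
  by (simp add: loop_associator_def)

lemma commutator_eq:
  assumes "x \<in> carrier G" "y \<in> carrier G"
  shows "x \<otimes> y = (y \<otimes> x) \<otimes> loop_commutator G x y"
  unfolding loop_commutator_def
  using left_inverse_property(1)[of "y \<otimes> x" "x \<otimes> y"] assms by (simp add: loop_inv_mult)

lemma associator_eq:
  assumes "x \<in> carrier G" "y \<in> carrier G" "z \<in> carrier G"
  shows "(x \<otimes> y) \<otimes> z = loop_associator G x y z \<otimes> (x \<otimes> (y \<otimes> z))"
  unfolding loop_associator_def
  using right_inverse_property(1)[of "x \<otimes> (y \<otimes> z)" "(x \<otimes> y) \<otimes> z"] assms by simp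

lemma pow_two: "x \<in> carrier G \<Longrightarrow> x [^] (2::nat) = x \<otimes> x"
  by (simp add: numeral_2_eq_2 nat_pow_def)

lemma pow_four: "x \<in> carrier G \<Longrightarrow> x [^] (4::nat) = ((x \<otimes> x) \<otimes> x) \<otimes> x"
  by (simp add: eval_nat_numeral nat_pow_def)

end

section \<open>Central involutions and the associator in the variety\<close>

text \<open>The elements of the centre whose square is \<open>\<one>\<close>, with
  \<open>\<one>\<close> included; associativity with \<open>c\<close> in the middle follows from the
  listed conditions. These elements act as scalars: squares, commutators and associators of a loop
  in the variety lie here, and so does the image of \<open>Z_grp\<close> later.\<close>

definition central_invol :: "('a, 'm) monoid_scheme \<Rightarrow> 'a set" where
  "central_invol G = {c \<in> carrier G. c \<otimes>\<^bsub>G\<^esub> c = \<one>\<^bsub>G\<^esub> \<and>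
     (\<forall>x \<in> carrier G. x \<otimes>\<^bsub>G\<^esub> c = c \<otimes>\<^bsub>G\<^esub> x \<and>
       (\<forall>y \<in> carrier G. (c \<otimes>\<^bsub>G\<^esub> x) \<otimes>\<^bsub>G\<^esub> y = c \<otimes>\<^bsub>G\<^esub> (x \<otimes>\<^bsub>G\<^esub> y) \<and>
          (x \<otimes>\<^bsub>G\<^esub> y) \<otimes>\<^bsub>G\<^esub> c = x \<otimes>\<^bsub>G\<^esub> (y \<otimes>\<^bsub>G\<^esub> c)))}"

section \<open>Computation in elementary abelian 2-groups\<close>

locale elementary_abelian_2 = comm_group +
  assumes square_one: "x \<in> carrier G \<Longrightarrow> x \<otimes> x = \<one>"
begin

lemma square_cancel: "\<lbrakk>x \<in> carrier G; y \<in> carrier G\<rbrakk> \<Longrightarrow> x \<otimes> (x \<otimes> y) = y"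
  using m_assoc[of x x y] by (simp add: square_one)

lemmas ac_simps2 = m_assoc m_comm m_lcomm square_one square_cancel

lemma eq_iff_mult_one:
  assumes "x \<in> carrier G" "y \<in> carrier G"
  shows "x = y \<longleftrightarrow> x \<otimes> y = \<one>"
proof
  assume "x \<otimes> y = \<one>"
  then have "\<one> \<otimes> y = x \<otimes> (y \<otimes> y)"
    using m_assoc[of x y y] assms by metis
  then show "x = y"
    using assms by (simp add: square_one)
qed (use assms in \<open>simp add: square_one\<close>)

text \<open>The factors over \<open>A \<inter> B\<close> occur twice on the right and cancel. The
  additivity of the cocycle and of \<open>zhom\<close> rests on this.\<close>

lemma finprod_sym_diff:
  assumes "finite A" "finite B" "f \<in> A \<union> B \<rightarrow> carrier G"
  shows "finprod G f (sym_diff A B) = finprod G f A \<otimes> finprod G f B"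
proof -
  have f: "f \<in> A - B \<rightarrow> carrier G" "f \<in> B - A \<rightarrow> carrier G" "f \<in> A \<inter> B \<rightarrow> carrier G"
    using assms by auto
  have "finprod G f ((A - B) \<union> (A \<inter> B)) = finprod G f (A - B) \<otimes> finprod G f (A \<inter> B)"
    using f assms by (intro finprod_Un_disjoint) auto
  moreover have "finprod G f ((B - A) \<union> (A \<inter> B)) = finprod G f (B - A) \<otimes> finprod G f (A \<inter> B)"
    using f assms by (intro finprod_Un_disjoint) auto
  moreover have "(A - B) \<union> (A \<inter> B) = A" "(B - A) \<union> (A \<inter> B) = B"
    by auto
  moreover have "finprod G f (sym_diff A B) = finprod G f (A - B) \<otimes> finprod G f (B - A)"
    using f assms by (intro finprod_Un_disjoint) auto
  moreover have "(x \<otimes> z) \<otimes> (y \<otimes> z) = x \<otimes> y"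
    if "x \<in> carrier G" "y \<in> carrier G" "z \<in> carrier G" for x y z
    using that by (simp add: ac_simps2)
  ultimately show ?thesis
    using f by (metis finprod_closed)
qed

end

section \<open>The group of central involutions of a Moufang loop\<close>

context moufang_loop
begin

text \<open>The hypotheses treat \<open>c\<close> in first position only. Inversion reverses
  products and fixes \<open>c\<close>, so it carries associativity with \<open>c\<close> on the left
  to associativity with \<open>c\<close> on the right.\<close>

lemma central_involI:
  assumes "c \<in> carrier G" "c \<otimes> c = \<one>"
    and comm: "\<And>t. t \<in> carrier G \<Longrightarrow> loop_commutator G c t = \<one>"
    and nuc: "\<And>y z. \<lbrakk>y \<in> carrier G; z \<in> carrier G\<rbrakk> \<Longrightarrow> loop_associator G c y z = \<one>"
  shows "c \<in> central_invol G"
proof -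
  have inv_c: "inv c = c"
    by (rule inv_eqI) fact+
  have left: "(c \<otimes> x) \<otimes> y = c \<otimes> (x \<otimes> y)" if "x \<in> carrier G" "y \<in> carrier G" for x y
    using associator_eq[of c x y] nuc[of x y] that assms(1) by simp
  have "(x \<otimes> y) \<otimes> c = x \<otimes> (y \<otimes> c)" if "x \<in> carrier G" "y \<in> carrier G" for x y
  proof -
    have "inv ((c \<otimes> inv y) \<otimes> inv x) = inv (c \<otimes> (inv y \<otimes> inv x))"
      using left that by simp
    then show ?thesis
      using that assms(1) by (simp add: loop_inv_mult loop_inv_inv inv_c)
  qed
  moreover have "x \<otimes> c = c \<otimes> x" if "x \<in> carrier G" for x
    using commutator_eq[of c x] comm[of x] unit_right[of "x \<otimes> c"] that assms(1) by force
  ultimately show ?thesis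
    using assms(1,2) left unfolding central_invol_def by blast
qed

lemma central_involD:
  assumes "c \<in> central_invol G"
  shows central_closed [simp]: "c \<in> carrier G"
    and central_square: "c \<otimes> c = \<one>"
    and central_comm: "x \<in> carrier G \<Longrightarrow> x \<otimes> c = c \<otimes> x"
    and central_assoc1: "\<lbrakk>x \<in> carrier G; y \<in> carrier G\<rbrakk> \<Longrightarrow> (c \<otimes> x) \<otimes> y = c \<otimes> (x \<otimes> y)"
    and central_assoc3: "\<lbrakk>x \<in> carrier G; y \<in> carrier G\<rbrakk> \<Longrightarrow> (x \<otimes> y) \<otimes> c = x \<otimes> (y \<otimes> c)"
  using assms unfolding central_invol_def by blast+

lemma central_assoc2:
  assumes "c \<in> central_invol G" "x \<in> carrier G" "y \<in> carrier G"
  shows "x \<otimes> (c \<otimes> y) = c \<otimes> (x \<otimes> y)"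
  by (metis assms central_assoc3 central_comm mult_closed)

lemma central_cancel:
  assumes "c \<in> central_invol G" "x \<in> carrier G"
  shows "c \<otimes> (c \<otimes> x) = x"
  by (metis assms central_assoc1 central_square central_closed unit_left)

lemma central_one [simp]: "\<one> \<in> central_invol G"
  unfolding central_invol_def by auto

lemma central_mult [simp]:
  assumes "c \<in> central_invol G" "d \<in> central_invol G"
  shows "c \<otimes> d \<in> central_invol G"
proof -
  have 1: "(c \<otimes> d) \<otimes> x = c \<otimes> (d \<otimes> x)" if "x \<in> carrier G" for x
    using that assms by (simp add: central_assoc1)
  have 2: "x \<otimes> (c \<otimes> d) = c \<otimes> (d \<otimes> x)" if "x \<in> carrier G" for x
    using central_assoc2[of c x d] central_comm[of d x] that assms by simp
  have 3: "(c \<otimes> d) \<otimes> (c \<otimes> d) = \<one>"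
    using 1[of "c \<otimes> d"] central_assoc2[of c d d] assms by (simp add: central_square central_cancel)
  have 4: "x \<otimes> (c \<otimes> d) = (c \<otimes> d) \<otimes> x" if "x \<in> carrier G" for x
    using 1 2 that by simp
  have 5: "((c \<otimes> d) \<otimes> x) \<otimes> y = (c \<otimes> d) \<otimes> (x \<otimes> y)"
    if "x \<in> carrier G" "y \<in> carrier G" for x y
    using that assms by (simp add: 1 central_assoc1)
  have 6: "(x \<otimes> y) \<otimes> (c \<otimes> d) = x \<otimes> (y \<otimes> (c \<otimes> d))"
    if "x \<in> carrier G" "y \<in> carrier G" for x y
    using central_assoc2[of c x "d \<otimes> y"] central_assoc2[of d x y] 2[of "x \<otimes> y"] 2[of y] that assms
    by simp
  have 7: "c \<otimes> d \<in> carrier G"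
    using assms by simp
  show ?thesis
    using 3 4 5 6 7 unfolding central_invol_def by blast
qed

lemma central_elementary: "elementary_abelian_2 (G\<lparr>carrier := central_invol G\<rparr>)"
proof -
  have "comm_group (G\<lparr>carrier := central_invol G\<rparr>)"
  proof (rule comm_groupI)
    fix x assume "x \<in> carrier (G\<lparr>carrier := central_invol G\<rparr>)"
    then show "\<exists>y \<in> carrier (G\<lparr>carrier := central_invol G\<rparr>).
        y \<otimes>\<^bsub>G\<lparr>carrier := central_invol G\<rparr>\<^esub> x = \<one>\<^bsub>G\<lparr>carrier := central_invol G\<rparr>\<^esub>"
      by (auto intro: central_square)
  qed (auto simp: central_assoc1 intro: central_comm)
  then show ?thesis
    by (auto simp: elementary_abelian_2_def elementary_abelian_2_axioms_def central_square)
qed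

end

text \<open>Makes abelian group rules and finite products available for central involutions. The
  rewrites state them with the multiplication of \<open>G\<close> itself, so that they mix with the
  loop laws.\<close>

sublocale moufang_loop \<subseteq> cen: elementary_abelian_2 "G\<lparr>carrier := central_invol G\<rparr>"
  rewrites "carrier (G\<lparr>carrier := central_invol G\<rparr>) = central_invol G"
    and "mult (G\<lparr>carrier := central_invol G\<rparr>) = mult G"
    and "one (G\<lparr>carrier := central_invol G\<rparr>) = one G"
  by (rule central_elementary) simp_all

section \<open>The associator as a symmetric, alternating, trilinear map\<close>

context variety_E
begin

abbreviation "K \<equiv> central_invol G"
abbreviation "asc \<equiv> loop_associator G"
abbreviation "com \<equiv> loop_commutator G"

lemma associator_central [simp]:
  assumes "x \<in> carrier G" "y \<in> carrier G" "z \<in> carrier G"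
  shows "asc x y z \<in> K"
  using assms assoc_pow2[OF assms] by (intro central_involI) (auto simp: pow_two assoc_comm assoc_assoc)

lemma commutator_central [simp]:
  assumes "x \<in> carrier G" "y \<in> carrier G"
  shows "com x y \<in> K"
  using assms comm_pow2[OF assms] by (intro central_involI) (auto simp: pow_two comm_comm comm_assoc)

lemma square_central [simp]:
  assumes "x \<in> carrier G"
  shows "x \<otimes> x \<in> K"
proof (rule central_involI)
  \<comment> \<open>The fourth power is left-normed; since a square associates with everything, it
    may be rebracketed as \<open>(x \<otimes> x) \<otimes> (x \<otimes> x)\<close>.\<close>
  have "asc (x \<otimes> x) x x = \<one>"
    using square_assoc[of x x x] assms by (simp add: pow_two)
  then show "(x \<otimes> x) \<otimes> (x \<otimes> x) = \<one>"
    using associator_eq[of "x \<otimes> x" x x] pow4[of x] assms by (simp add: pow_four)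
qed (use assms square_comm[of x] square_assoc[of x] in \<open>auto simp: pow_two\<close>)

lemma associator_eqI:
  assumes "a \<in> K" "x \<in> carrier G" "y \<in> carrier G" "z \<in> carrier G"
    and "(x \<otimes> y) \<otimes> z = a \<otimes> (x \<otimes> (y \<otimes> z))"
  shows "asc x y z = a"
  using right_cancel[of "x \<otimes> (y \<otimes> z)" "asc x y z" a] associator_eq[of x y z] assms by simp

text \<open>A central factor can be pulled out of both bracketings alike, so the associator depends
  only on classes modulo \<open>K\<close>.\<close>

lemma associator_central_mult:
  assumes k: "k \<in> K" and xyz: "x \<in> carrier G" "y \<in> carrier G" "z \<in> carrier G"
  shows "asc (k \<otimes> x) y z = asc x y z"
    and "asc x (k \<otimes> y) z = asc x y z"
    and "asc x y (k \<otimes> z) = asc x y z"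
  using assms associator_eq[OF xyz]
  by (auto intro!: associator_eqI simp: central_assoc1[OF k] central_assoc2[OF k])

lemma associator_central_one:
  assumes k: "k \<in> K" and xy: "x \<in> carrier G" "y \<in> carrier G"
  shows "asc k x y = \<one>" "asc x k y = \<one>" "asc x y k = \<one>"
  using assms
  by (auto intro!: associator_eqI simp: central_assoc1[OF k] central_assoc2[OF k] central_comm[OF k])

lemma mult_swap:
  assumes "x \<in> carrier G" "y \<in> carrier G"
  shows "x \<otimes> y = com x y \<otimes> (y \<otimes> x)"
  using commutator_eq[of x y] central_comm[of "com x y" "y \<otimes> x"] assms by simp

lemma associator_mult_swap:
  assumes "x \<in> carrier G" "y \<in> carrier G" "u \<in> carrier G" "v \<in> carrier G"
  shows "asc (x \<otimes> y) u v = asc (y \<otimes> x) u v"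
    and "asc u (x \<otimes> y) v = asc u (y \<otimes> x) v"
    and "asc u v (x \<otimes> y) = asc u v (y \<otimes> x)"
  using assms by (simp_all add: mult_swap[of x y] associator_central_mult)

text \<open>Exhibits \<open>inv x\<close> as a central square times \<open>x\<close>; hence the
  associator does not see inverses.\<close>

lemma inv_eq_central_mult: "x \<in> carrier G \<Longrightarrow> inv x = (inv x \<otimes> inv x) \<otimes> x"
  by (simp add: right_inverse_property)

lemma associator_inv:
  assumes "x \<in> carrier G" "y \<in> carrier G" "z \<in> carrier G"
  shows "asc (inv x) y z = asc x y z" "asc x (inv y) z = asc x y z" "asc x y (inv z) = asc x y z"
  using assms by (metis inv_eq_central_mult associator_central_mult square_central loop_inv_closed)+

text \<open>Inverting the equation that defines the associator reverses all products and moves the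
  associator to the other side; the inverses on the arguments are then dropped by
  \<open>associator_inv\<close>.\<close>

lemma associator_reverse:
  assumes "x \<in> carrier G" "y \<in> carrier G" "z \<in> carrier G"
  shows "asc z y x = asc x y z"
proof -
  let ?a = "asc x y z"
  have a: "?a \<in> K"
    using assms by simp
  have inv_a: "inv ?a = ?a"
    using a by (intro inv_eqI) (auto simp: central_square)
  have "inv ((x \<otimes> y) \<otimes> z) = inv (?a \<otimes> (x \<otimes> (y \<otimes> z)))"
    using associator_eq assms by simp
  then have "inv z \<otimes> (inv y \<otimes> inv x) = ((inv z \<otimes> inv y) \<otimes> inv x) \<otimes> ?a"
    using assms by (simp add: loop_inv_mult inv_a)
  also have "\<dots> = ?a \<otimes> ((inv z \<otimes> inv y) \<otimes> inv x)"
    using central_comm[OF a] assms by simp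
  finally have "?a \<otimes> (inv z \<otimes> (inv y \<otimes> inv x)) = (inv z \<otimes> inv y) \<otimes> inv x"
    using central_cancel[OF a] assms by simp
  then have "asc (inv z) (inv y) (inv x) = ?a"
    using assms by (intro associator_eqI) auto
  then show ?thesis
    using assms by (simp add: associator_inv)
qed

lemma associator_repeat_outer:
  assumes "x \<in> carrier G" "y \<in> carrier G"
  shows "asc x y x = \<one>"
  using assms by (intro associator_eqI) (auto simp: flexible)

text \<open>Both sides of the Moufang identity are measured against
  \<open>x \<otimes> (y \<otimes> (z \<otimes> x))\<close>. The two factors on the right are the
  costs of rebracketing first the outer \<open>x\<close> and then \<open>y\<close>,
  \<open>z\<close>, \<open>x\<close>.\<close>

lemma associator_moufang:
  assumes "x \<in> carrier G" "y \<in> carrier G" "z \<in> carrier G"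
  shows "asc x y (z \<otimes> x) = asc x (y \<otimes> z) x \<otimes> asc y z x"
proof -
  have "asc x y (z \<otimes> x) \<otimes> (x \<otimes> (y \<otimes> (z \<otimes> x))) = (x \<otimes> y) \<otimes> (z \<otimes> x)"
    using associator_eq assms by simp
  also have "\<dots> = (x \<otimes> (y \<otimes> z)) \<otimes> x"
    using moufang assms by simp
  also have "\<dots> = x \<otimes> ((y \<otimes> z) \<otimes> x)"
    using flexible assms by simp
  also have "\<dots> = asc y z x \<otimes> (x \<otimes> (y \<otimes> (z \<otimes> x)))"
    using associator_eq[of y z x] assms by (simp add: central_assoc2[of "asc y z x" x])
  finally have "asc x y (z \<otimes> x) = asc y z x"
    by (rule right_cancel[rotated -1]) (use assms in auto)
  then show ?thesis
    using assms by (simp add: associator_repeat_outer)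
qed

text \<open>The word \<open>((x \<otimes> y) \<otimes> z) \<otimes> w\<close> is brought to
  \<open>x \<otimes> (y \<otimes> (z \<otimes> w))\<close> along two paths, of two and of three
  rebracketings. The costs are central, so they multiply.\<close>

lemma associator_pentagon:
  assumes "x \<in> carrier G" "y \<in> carrier G" "z \<in> carrier G" "w \<in> carrier G"
  shows "asc (x \<otimes> y) z w \<otimes> asc x y (z \<otimes> w) =
    asc x y z \<otimes> (asc x (y \<otimes> z) w \<otimes> asc y z w)"
proof (rule right_cancel)
  have "(asc (x \<otimes> y) z w \<otimes> asc x y (z \<otimes> w)) \<otimes> (x \<otimes> (y \<otimes> (z \<otimes> w)))
      = asc (x \<otimes> y) z w \<otimes> ((x \<otimes> y) \<otimes> (z \<otimes> w))"
    using associator_eq[of x y "z \<otimes> w"] assms by (simp add: central_assoc1)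
  also have "\<dots> = ((x \<otimes> y) \<otimes> z) \<otimes> w"
    using associator_eq[of "x \<otimes> y" z w] assms by simp
  also have "\<dots> = asc x y z \<otimes> ((x \<otimes> (y \<otimes> z)) \<otimes> w)"
    using associator_eq[of x y z] assms by (simp add: central_assoc1)
  also have "\<dots> = asc x y z \<otimes> (asc x (y \<otimes> z) w \<otimes> (x \<otimes> ((y \<otimes> z) \<otimes> w)))"
    using associator_eq[of x "y \<otimes> z" w] assms by simp
  also have "\<dots> = asc x y z \<otimes> (asc x (y \<otimes> z) w \<otimes> (asc y z w \<otimes> (x \<otimes> (y \<otimes> (z \<otimes> w)))))"
    using associator_eq[of y z w] assms by (simp add: central_assoc2[of "asc y z w" x])
  also have "\<dots> = (asc x y z \<otimes> (asc x (y \<otimes> z) w \<otimes> asc y z w)) \<otimes> (x \<otimes> (y \<otimes> (z \<otimes> w)))"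
    using assms by (simp add: central_assoc1)
  finally show "(asc (x \<otimes> y) z w \<otimes> asc x y (z \<otimes> w)) \<otimes> (x \<otimes> (y \<otimes> (z \<otimes> w))) =
    (asc x y z \<otimes> (asc x (y \<otimes> z) w \<otimes> asc y z w)) \<otimes> (x \<otimes> (y \<otimes> (z \<otimes> w)))" .
qed (use assms in auto)

text \<open>Writing \<open>z\<close> as \<open>(z \<otimes> inv x) \<otimes> x\<close> makes the
  Moufang rule applicable. Afterwards \<open>inv x\<close> commutes with \<open>z\<close> and turns
  into \<open>x\<close> modulo central elements, and reversal restores the order.\<close>

lemma associator_shift:
  assumes "x \<in> carrier G" "y \<in> carrier G" "z \<in> carrier G"
  shows "asc x y z = asc x (x \<otimes> z) y"
proof -
  have "asc x y z = asc x y ((z \<otimes> inv x) \<otimes> x)"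
    using assms by (simp add: right_inverse_property)
  also have "\<dots> = asc y (z \<otimes> inv x) x"
    using assms by (subst associator_moufang) (auto simp: associator_repeat_outer)
  also have "\<dots> = asc y (inv x \<otimes> z) x"
    using assms by (simp add: associator_mult_swap(2)[of z "inv x"])
  also have "inv x \<otimes> z = (inv x \<otimes> inv x) \<otimes> (x \<otimes> z)"
    using assms by (subst inv_eq_central_mult) (auto simp: central_assoc1)
  also have "asc y \<dots> x = asc y (x \<otimes> z) x"
    using assms by (simp add: associator_central_mult)
  finally show ?thesis
    using associator_reverse[of y "x \<otimes> z" x] assms by simp
qed

text \<open>The shift turns \<open>asc x x y\<close> into \<open>asc x (x \<otimes> y) x\<close>,
  which is trivial by flexibility; reversal gives the other law.\<close>

lemma associator_repeat:
  assumes "x \<in> carrier G" "y \<in> carrier G"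
  shows "asc x x y = \<one>" "asc y x x = \<one>"
proof -
  show "asc x x y = \<one>"
    using associator_shift[of x x y] assms by (simp add: associator_repeat_outer)
  then show "asc y x x = \<one>"
    using associator_reverse[of y x x] assms by simp
qed

lemma associator_swap_right:
  assumes "x \<in> carrier G" "y \<in> carrier G" "z \<in> carrier G"
  shows "asc x y z = asc x z y"
proof -
  \<comment> \<open>In the pentagon for \<open>x\<close>, \<open>x\<close>, \<open>z\<close>,
    \<open>y\<close> the terms with a central or a repeated argument vanish. The two that remain
    have product \<open>\<one>\<close>, hence agree.\<close>
  have "asc x (x \<otimes> z) y = asc x z y"
    using associator_pentagon[of x x z y] assms
    by (simp add: associator_repeat associator_central_one)
       (metis assms associator_central central_cancel central_square mult_closed cen.eq_iff_mult_one)
  then show ?thesis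
    using associator_shift[of x y z] assms by simp
qed

lemma associator_swap_left:
  assumes "x \<in> carrier G" "y \<in> carrier G" "z \<in> carrier G"
  shows "asc x y z = asc y x z"
  using assms by (metis associator_reverse associator_swap_right)

text \<open>
  The defect \<open>D\<close> of additivity is symmetric in its first and in its last two arguments, and the
  pentagon identity says that the sum of three of its permutations vanishes. Hence \<open>D\<close> is fully
  symmetric, and \<open>3 D = D\<close> vanishes.
\<close>

lemma associator_mult:
  assumes xyzw: "x \<in> carrier G" "y \<in> carrier G" "z \<in> carrier G" "w \<in> carrier G"
  shows "asc (x \<otimes> y) z w = asc x z w \<otimes> asc y z w"
proof -
  define D where "D x y z w = asc (x \<otimes> y) z w \<otimes> (asc x z w \<otimes> asc y z w)" for x y z w
  have D_K: "D x y z w \<in> K"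
    if "x \<in> carrier G" "y \<in> carrier G" "z \<in> carrier G" "w \<in> carrier G" for x y z w
    using that by (simp add: D_def)
  have sym1: "D x y z w = D y x z w"
    if "x \<in> carrier G" "y \<in> carrier G" "z \<in> carrier G" "w \<in> carrier G" for x y z w
    using that by (simp add: D_def associator_mult_swap(1)[of x y] cen.m_comm)
  have sym2: "D x y z w = D x y w z"
    if "x \<in> carrier G" "y \<in> carrier G" "z \<in> carrier G" "w \<in> carrier G" for x y z w
    using that by (simp add: D_def associator_swap_right[of _ z w])
  have pent: "D x y z w \<otimes> (D y z x w \<otimes> D z w x y) = \<one>"
    if xyzw: "x \<in> carrier G" "y \<in> carrier G" "z \<in> carrier G" "w \<in> carrier G" for x y z w
  proof -
    have sw: "asc x y (z \<otimes> w) = asc (z \<otimes> w) x y" "asc x (y \<otimes> z) w = asc (y \<otimes> z) x w"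
      "asc z x w = asc x z w" "asc y x w = asc x y w" "asc w x y = asc x y w" "asc z x y = asc x y z"
      using xyzw associator_swap_right[of x y "z \<otimes> w"] associator_swap_left[of x "z \<otimes> w" y]
        associator_swap_left[of x "y \<otimes> z" w] associator_swap_left[of z x w] associator_swap_left[of y x w]
        associator_swap_left[of w x y] associator_swap_right[of x w y]
        associator_swap_left[of z x y] associator_swap_right[of x z y]
      by auto
    \<comment> \<open>In the product of the three defects, \<open>a\<close> and \<open>c\<close>
      occur twice and cancel. What remains is the pentagon identity, stated as the first
      premise.\<close>
    have *: "A1 \<otimes> (a \<otimes> b) \<otimes> ((A2 \<otimes> (c \<otimes> a)) \<otimes> (A3 \<otimes> (d \<otimes> c))) = \<one>"
      if "A1 \<otimes> A3 = d \<otimes> (A2 \<otimes> b)" "A1 \<in> K" "A2 \<in> K" "A3 \<in> K" "a \<in> K" "b \<in> K" "c \<in> K" "d \<in> K"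
      for A1 A2 A3 a b c d
    proof -
      have "A1 \<otimes> (a \<otimes> b) \<otimes> ((A2 \<otimes> (c \<otimes> a)) \<otimes> (A3 \<otimes> (d \<otimes> c))) = (A1 \<otimes> A3) \<otimes> (A2 \<otimes> (b \<otimes> d))"
        using that(2-) by (simp add: cen.ac_simps2)
      also have "\<dots> = (d \<otimes> (A2 \<otimes> b)) \<otimes> (A2 \<otimes> (b \<otimes> d))"
        using that(1) by simp
      also have "\<dots> = \<one>"
        using that(2-) by (simp add: cen.ac_simps2)
      finally show ?thesis .
    qed
    show ?thesis
      unfolding D_def sw
      by (rule *[OF associator_pentagon[OF xyzw, unfolded sw]]) (use xyzw in simp_all)
  qed
  \<comment> \<open>Interchanging \<open>x\<close> and \<open>y\<close> in \<open>pent\<close>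
    leaves the outer two factors unchanged by \<open>sym1\<close> and \<open>sym2\<close>, so the
    middle factors must agree.\<close>
  have sym3: "D y z x w = D x z y w"
    if xyzw: "x \<in> carrier G" "y \<in> carrier G" "z \<in> carrier G" "w \<in> carrier G" for x y z w
  proof -
    have *: "b = c" if "a \<otimes> (b \<otimes> d) = \<one>" "a \<otimes> (c \<otimes> d) = \<one>" "a \<in> K" "b \<in> K" "c \<in> K" "d \<in> K" for a b c d
    proof (rule right_cancel[of d])
      show "b \<otimes> d = c \<otimes> d"
        by (rule left_cancel[of a]) (use that in simp_all)
    qed (use that in simp_all)
    show ?thesis
    proof (rule *)
      show "D x y z w \<otimes> (D y z x w \<otimes> D z w x y) = \<one>"
        by (rule pent) fact+
      show "D x y z w \<otimes> (D x z y w \<otimes> D z w x y) = \<one>"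
        unfolding sym1[OF xyzw] sym2[OF xyzw(3,4,1,2)] by (rule pent) fact+
    qed (use xyzw in \<open>simp_all add: D_K\<close>)
  qed
  have "D y z x w = D x y z w"
    using xyzw sym1[of y z x w] sym3[of x z y w] by simp
  moreover have "D z w x y = D x y z w"
    using xyzw sym2[of z w x y] sym3[of y z w x] sym1[of y w z x] sym2[of w y z x]
      sym3[of x w y z] sym2[of x y w z] by simp
  ultimately have "D x y z w = \<one>"
    using pent[OF xyzw] D_K[OF xyzw] by (simp add: cen.square_one central_square)
  then show ?thesis
    using xyzw unfolding D_def by (subst cen.eq_iff_mult_one) auto
qed

text \<open>Swapping twice shows the two commutators to be mutually inverse, and they are
  involutions.\<close>

lemma commutator_sym:
  assumes "x \<in> carrier G" "y \<in> carrier G"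
  shows "com x y = com y x"
proof (rule right_cancel)
  show "com x y \<otimes> (y \<otimes> x) = com y x \<otimes> (y \<otimes> x)"
    using mult_swap[of x y] mult_swap[of y x] central_cancel[of "com y x" "x \<otimes> y"] assms by simp
qed (use assms in auto)

end

section \<open>The cocycle of \<open>\<F>\<close>\<close>

lemma elementary_abelian_2_elem_ab2: "elementary_abelian_2 (elem_ab2 B)"
proof -
  have "comm_group (elem_ab2 B)"
    by (rule comm_groupI) (auto simp: elem_ab2_def)
  then show ?thesis
    by (simp add: elementary_abelian_2_def elementary_abelian_2_axioms_def) (simp add: elem_ab2_def)
qed

lemma elementary_abelian_2_DirProd:
  assumes "elementary_abelian_2 A" "elementary_abelian_2 B"
  shows "elementary_abelian_2 (A \<times>\<times> B)"
proof -
  interpret A: elementary_abelian_2 A by fact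
  interpret B: elementary_abelian_2 B by fact
  have "comm_group (A \<times>\<times> B)"
    by (intro group.group_comm_groupI DirProd_group A.group_axioms B.group_axioms)
       (auto simp: A.m_comm B.m_comm)
  then show ?thesis
    by (auto simp: elementary_abelian_2_def elementary_abelian_2_axioms_def A.square_one B.square_one)
qed

interpretation V: elementary_abelian_2 V_grp
  unfolding V_grp_def by (rule elementary_abelian_2_elem_ab2)

interpretation Z: elementary_abelian_2 Z_grp
  unfolding Z_grp_def Vbar_grp_def W_grp_def U_grp_def
  by (intro elementary_abelian_2_DirProd elementary_abelian_2_elem_ab2)

abbreviation zmult (infixl "\<odot>" 70) where "z \<odot> w \<equiv> z \<otimes>\<^bsub>Z_grp\<^esub> w"
abbreviation zone ("\<one>\<^sub>Z") where "\<one>\<^sub>Z \<equiv> \<one>\<^bsub>Z_grp\<^esub>"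
abbreviation VV where "VV \<equiv> carrier V_grp"
abbreviation ZZ where "ZZ \<equiv> carrier Z_grp"

lemma V_carrier: "\<sigma> \<in> VV \<longleftrightarrow> finite \<sigma> \<and> \<sigma> \<subseteq> {1..}"
  by (simp add: V_grp_def elem_ab2_def)

lemma V_mult: "\<sigma> \<otimes>\<^bsub>V_grp\<^esub> \<mu> = sym_diff \<sigma> \<mu>"
  by (simp add: V_grp_def elem_ab2_def)

lemma V_one: "\<one>\<^bsub>V_grp\<^esub> = {}"
  by (simp add: V_grp_def elem_ab2_def)

lemma V_closed [simp]: "{} \<in> VV" "\<sigma> \<in> VV \<Longrightarrow> \<mu> \<in> VV \<Longrightarrow> sym_diff \<sigma> \<mu> \<in> VV"
  using V.m_closed[of \<sigma> \<mu>] V.one_closed by (auto simp: V_mult V_one)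

lemma V_ge_1: "\<sigma> \<in> VV \<Longrightarrow> i \<in> \<sigma> \<Longrightarrow> i \<ge> 1"
  by (auto simp: V_carrier)

lemma V_finite [simp]: "\<sigma> \<in> VV \<Longrightarrow> finite \<sigma>"
  by (simp add: V_carrier)

lemma ZZ_iff: "(A, B, C) \<in> ZZ \<longleftrightarrow> finite A \<and> A \<subseteq> {1..} \<and>
    finite B \<and> B \<subseteq> {P. P \<subseteq> {1..} \<and> card P = 2} \<and> finite C \<and> C \<subseteq> {T. T \<subseteq> {1..} \<and> card T = 3}"
  by (auto simp: Z_grp_def Vbar_grp_def W_grp_def U_grp_def elem_ab2_def)

lemma Z_mult: "(A, B, C) \<odot> (A', B', C') = (sym_diff A A', sym_diff B B', sym_diff C C')"
  by (simp add: Z_grp_def Vbar_grp_def W_grp_def U_grp_def elem_ab2_def)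

lemma Z_one: "\<one>\<^sub>Z = ({}, {}, {})"
  by (simp add: Z_grp_def Vbar_grp_def W_grp_def U_grp_def elem_ab2_def)

lemma symbols_closed:
  "i \<ge> 1 \<Longrightarrow> bar_sym i \<in> ZZ"
  "i \<ge> 1 \<Longrightarrow> j \<ge> 1 \<Longrightarrow> wedge2 i j \<in> ZZ"
  "i \<ge> 1 \<Longrightarrow> j \<ge> 1 \<Longrightarrow> k \<ge> 1 \<Longrightarrow> wedge3 i j k \<in> ZZ"
  by (auto simp: bar_sym_def wedge2_def wedge3_def ZZ_iff card_insert_if)

lemma wedge3_sym: "wedge3 i j k = wedge3 j i k" "wedge3 i j k = wedge3 i k j"
  by (auto simp: wedge3_def insert_commute)

section \<open>The parts of the cocycle and their dependence on each argument\<close>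

definition bar_part :: "nat set \<Rightarrow> nat set \<Rightarrow> zelem" where
  "bar_part \<sigma> \<mu> = finprod Z_grp bar_sym (\<sigma> \<inter> \<mu>)"

definition pair_part :: "nat set \<Rightarrow> nat set \<Rightarrow> zelem" where
  "pair_part \<sigma> \<mu> = finprod Z_grp (\<lambda>(i, j). wedge2 i j) {(i, j). i \<in> \<sigma> \<and> j \<in> \<mu> \<and> i > j}"

definition triple_part :: "nat set \<Rightarrow> nat set \<Rightarrow> zelem" where
  "triple_part \<sigma> \<mu> = finprod Z_grp (\<lambda>(i, j, k). wedge3 i j k)
     {(i, j, k). i \<in> \<sigma> \<and> j \<in> \<mu> \<and> k \<in> \<mu> \<and> j < k}"

text \<open>The trilinear extension of \<open>wedge3\<close> to \<open>V_grp\<close>. It is the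
  polarization of \<open>triple_part\<close> in the second argument.\<close>

definition wedge_tri :: "nat set \<Rightarrow> nat set \<Rightarrow> nat set \<Rightarrow> zelem" where
  "wedge_tri \<sigma> \<mu> \<nu> = finprod Z_grp (\<lambda>(i, j, k). wedge3 i j k) (\<sigma> \<times> \<mu> \<times> \<nu>)"

lemma F_factor_parts: "F_factor \<sigma> \<mu> = bar_part \<sigma> \<mu> \<odot> pair_part \<sigma> \<mu> \<odot> triple_part \<sigma> \<mu>"
  by (simp add: F_factor_def bar_part_def pair_part_def triple_part_def)

lemma finite_pairs: "\<sigma> \<in> VV \<Longrightarrow> \<mu> \<in> VV \<Longrightarrow> finite {(i, j). i \<in> \<sigma> \<and> j \<in> \<mu> \<and> P i j}"
  by (rule finite_subset[of _ "\<sigma> \<times> \<mu>"]) auto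

lemma parts_closed [simp]:
  assumes "\<sigma> \<in> VV" "\<mu> \<in> VV"
  shows "bar_part \<sigma> \<mu> \<in> ZZ" "pair_part \<sigma> \<mu> \<in> ZZ" "triple_part \<sigma> \<mu> \<in> ZZ"
  using assms unfolding bar_part_def pair_part_def triple_part_def
  by (auto intro!: Z.finprod_closed symbols_closed dest: V_ge_1)

lemma wedge_tri_closed [simp]:
  assumes "\<sigma> \<in> VV" "\<mu> \<in> VV" "\<nu> \<in> VV"
  shows "wedge_tri \<sigma> \<mu> \<nu> \<in> ZZ"
  using assms unfolding wedge_tri_def
  by (auto intro!: Z.finprod_closed symbols_closed dest: V_ge_1)

lemma F_factor_closed [simp]: "\<sigma> \<in> VV \<Longrightarrow> \<mu> \<in> VV \<Longrightarrow> F_factor \<sigma> \<mu> \<in> ZZ"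
  by (simp add: F_factor_parts)

lemma finprod_Z_sym_diff:
  assumes "C = sym_diff A B" "finite A" "finite B" "\<And>x. x \<in> A \<union> B \<Longrightarrow> f x \<in> ZZ"
  shows "finprod Z_grp f C = finprod Z_grp f A \<odot> finprod Z_grp f B"
  using assms Z.finprod_sym_diff[of A B f] by auto

lemma bar_part_sym_diff_left:
  assumes "\<sigma> \<in> VV" "\<tau> \<in> VV" "\<mu> \<in> VV"
  shows "bar_part (sym_diff \<sigma> \<tau>) \<mu> = bar_part \<sigma> \<mu> \<odot> bar_part \<tau> \<mu>"
  unfolding bar_part_def
  by (rule finprod_Z_sym_diff) (use assms in \<open>auto intro!: symbols_closed dest: V_ge_1\<close>)

lemma bar_part_sym_diff_right:
  assumes "\<sigma> \<in> VV" "\<tau> \<in> VV" "\<mu> \<in> VV"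
  shows "bar_part \<mu> (sym_diff \<sigma> \<tau>) = bar_part \<mu> \<sigma> \<odot> bar_part \<mu> \<tau>"
  unfolding bar_part_def
  by (rule finprod_Z_sym_diff) (use assms in \<open>auto intro!: symbols_closed dest: V_ge_1\<close>)

lemma pair_part_sym_diff_left:
  assumes "\<sigma> \<in> VV" "\<tau> \<in> VV" "\<mu> \<in> VV"
  shows "pair_part (sym_diff \<sigma> \<tau>) \<mu> = pair_part \<sigma> \<mu> \<odot> pair_part \<tau> \<mu>"
  unfolding pair_part_def
  by (rule finprod_Z_sym_diff)
     (use assms in \<open>auto intro!: symbols_closed finite_pairs dest: V_ge_1\<close>)

lemma pair_part_sym_diff_right:
  assumes "\<sigma> \<in> VV" "\<tau> \<in> VV" "\<mu> \<in> VV"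
  shows "pair_part \<mu> (sym_diff \<sigma> \<tau>) = pair_part \<mu> \<sigma> \<odot> pair_part \<mu> \<tau>"
  unfolding pair_part_def
  by (rule finprod_Z_sym_diff)
     (use assms in \<open>auto intro!: symbols_closed finite_pairs dest: V_ge_1\<close>)

lemma triple_part_sym_diff_left:
  assumes "\<sigma> \<in> VV" "\<tau> \<in> VV" "\<mu> \<in> VV"
  shows "triple_part (sym_diff \<sigma> \<tau>) \<mu> = triple_part \<sigma> \<mu> \<odot> triple_part \<tau> \<mu>"
  unfolding triple_part_def
  by (rule finprod_Z_sym_diff)
     (use assms in \<open>auto intro!: symbols_closed finite_cartesian_product finite_pairs dest: V_ge_1\<close>)

lemma wedge_tri_sym_diff:
  assumes "\<sigma> \<in> VV" "\<tau> \<in> VV" "\<mu> \<in> VV" "\<nu> \<in> VV"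
  shows "wedge_tri (sym_diff \<sigma> \<tau>) \<mu> \<nu> = wedge_tri \<sigma> \<mu> \<nu> \<odot> wedge_tri \<tau> \<mu> \<nu>"
  unfolding wedge_tri_def
  by (rule finprod_Z_sym_diff) (use assms in \<open>auto intro!: symbols_closed dest: V_ge_1\<close>)

lemma wedge_tri_swap_left:
  assumes "\<sigma> \<in> VV" "\<mu> \<in> VV" "\<nu> \<in> VV"
  shows "wedge_tri \<sigma> \<mu> \<nu> = wedge_tri \<mu> \<sigma> \<nu>"
proof -
  let ?h = "\<lambda>(i, j, k). (j, i, k)" and ?w = "\<lambda>(i, j, k). wedge3 i j k"
  have "finprod Z_grp ?w (?h ` (\<sigma> \<times> \<mu> \<times> \<nu>)) = finprod Z_grp (\<lambda>p. ?w (?h p)) (\<sigma> \<times> \<mu> \<times> \<nu>)"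
    using assms
    by (intro Z.finprod_reindex) (auto intro!: symbols_closed inj_onI dest: V_ge_1)
  moreover have "?h ` (\<sigma> \<times> \<mu> \<times> \<nu>) = \<mu> \<times> \<sigma> \<times> \<nu>"
    by force
  moreover have "(\<lambda>p. ?w (?h p)) = ?w"
    by (auto simp: fun_eq_iff wedge3_sym(1))
  ultimately show ?thesis
    by (simp add: wedge_tri_def)
qed

lemma wedge_tri_swap_right:
  assumes "\<sigma> \<in> VV" "\<mu> \<in> VV" "\<nu> \<in> VV"
  shows "wedge_tri \<sigma> \<mu> \<nu> = wedge_tri \<sigma> \<nu> \<mu>"
proof -
  let ?h = "\<lambda>(i, j, k). (i, k, j)" and ?w = "\<lambda>(i, j, k). wedge3 i j k"
  have "finprod Z_grp ?w (?h ` (\<sigma> \<times> \<mu> \<times> \<nu>)) = finprod Z_grp (\<lambda>p. ?w (?h p)) (\<sigma> \<times> \<mu> \<times> \<nu>)"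
    using assms
    by (intro Z.finprod_reindex) (auto intro!: symbols_closed inj_onI dest: V_ge_1)
  moreover have "?h ` (\<sigma> \<times> \<mu> \<times> \<nu>) = \<sigma> \<times> \<nu> \<times> \<mu>"
    by force
  moreover have "(\<lambda>p. ?w (?h p)) = ?w"
    by (auto simp: fun_eq_iff wedge3_sym(2))
  ultimately show ?thesis
    by (simp add: wedge_tri_def)
qed

text \<open>Modulo 2, the increasing pairs from \<open>sym_diff \<mu> \<nu>\<close> are those within
  \<open>\<mu>\<close>, those within \<open>\<nu>\<close> and the mixed ones, \<open>A\<close> and
  \<open>B\<close>. Symmetry of \<open>wedge3\<close> reflects \<open>B\<close> to the decreasing
  pairs \<open>B'\<close>, the diagonal \<open>E\<close> contributes only trivial symbols, and
  \<open>A\<close>, \<open>B'\<close>, \<open>E\<close> together fill the box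
  \<open>\<sigma> \<times> \<mu> \<times> \<nu>\<close>.\<close>

lemma triple_part_sym_diff_right:
  assumes "\<sigma> \<in> VV" "\<mu> \<in> VV" "\<nu> \<in> VV"
  shows "triple_part \<sigma> (sym_diff \<mu> \<nu>) =
    triple_part \<sigma> \<mu> \<odot> triple_part \<sigma> \<nu> \<odot> wedge_tri \<sigma> \<mu> \<nu>"
proof -
  let ?w = "\<lambda>(i, j, k). wedge3 i j k" and ?h = "\<lambda>(i, j, k). (i, k, j)"
  let ?S = "\<lambda>\<mu>. {(i, j, k). i \<in> \<sigma> \<and> j \<in> \<mu> \<and> k \<in> \<mu> \<and> j < k}"
  define A where "A = {(i, j, k). i \<in> \<sigma> \<and> j \<in> \<mu> \<and> k \<in> \<nu> \<and> j < k}"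
  define B where "B = {(i, j, k). i \<in> \<sigma> \<and> j \<in> \<nu> \<and> k \<in> \<mu> \<and> j < k}"
  define B' where "B' = {(i, j, k). i \<in> \<sigma> \<and> j \<in> \<mu> \<and> k \<in> \<nu> \<and> k < j}"
  define E where "E = {(i, j, k). i \<in> \<sigma> \<and> j \<in> \<mu> \<and> k \<in> \<nu> \<and> j = k}"
  have fin: "finite A" "finite B" "finite B'" "finite E" "finite (?S \<mu>)" "finite (?S \<nu>)"
    using assms unfolding A_def B_def B'_def E_def by (auto intro!: finite_cartesian_product finite_pairs)
  have w: "?w p \<in> ZZ" if "p \<in> A \<union> B \<union> B' \<union> E \<union> ?S \<mu> \<union> ?S \<nu>" for p
    using that assms unfolding A_def B_def B'_def E_def
    by (auto intro!: symbols_closed dest: V_ge_1)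
  have "finprod Z_grp ?w (?h ` B') = finprod Z_grp (\<lambda>p. ?w (?h p)) B'"
    using assms unfolding B'_def
    by (intro Z.finprod_reindex) (auto intro!: symbols_closed inj_onI dest: V_ge_1)
  moreover have "?h ` B' = B"
    unfolding B_def B'_def by force
  moreover have "(\<lambda>p. ?w (?h p)) = ?w"
    by (auto simp: fun_eq_iff wedge3_sym(2))
  ultimately have B: "finprod Z_grp ?w B = finprod Z_grp ?w B'"
    by simp
  have E: "finprod Z_grp ?w E = \<one>\<^sub>Z"
    by (rule Z.finprod_one_eqI) (auto simp: E_def wedge3_def)
  have "finprod Z_grp ?w (?S (sym_diff \<mu> \<nu>)) =
      finprod Z_grp ?w (sym_diff (?S \<mu>) (?S \<nu>)) \<odot> finprod Z_grp ?w (sym_diff A B)"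
    by (rule finprod_Z_sym_diff) (use fin w in \<open>auto simp: A_def B_def\<close>)
  also have "finprod Z_grp ?w (sym_diff (?S \<mu>) (?S \<nu>)) = triple_part \<sigma> \<mu> \<odot> triple_part \<sigma> \<nu>"
    unfolding triple_part_def using fin w by (intro finprod_Z_sym_diff) auto
  also have "finprod Z_grp ?w (sym_diff A B) = finprod Z_grp ?w A \<odot> finprod Z_grp ?w B"
    using fin w by (intro finprod_Z_sym_diff) auto
  also have "\<dots> = finprod Z_grp ?w A \<odot> finprod Z_grp ?w B' \<odot> finprod Z_grp ?w E"
    using w by (simp add: B E Z.finprod_closed)
  also have "\<dots> = finprod Z_grp ?w (sym_diff A B') \<odot> finprod Z_grp ?w E"
    using fin w by (subst finprod_Z_sym_diff[of _ A B']) auto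
  also have "\<dots> = wedge_tri \<sigma> \<mu> \<nu>"
    unfolding wedge_tri_def
    by (rule finprod_Z_sym_diff[symmetric]) (use fin w in \<open>auto simp: A_def B'_def E_def\<close>)
  finally show ?thesis
    by (simp add: triple_part_def)
qed

lemma wedge_tri_empty: "wedge_tri {} \<mu> \<nu> = \<one>\<^sub>Z"
  by (simp add: wedge_tri_def)

lemma wedge_tri_singletons:
  "i \<ge> 1 \<Longrightarrow> j \<ge> 1 \<Longrightarrow> k \<ge> 1 \<Longrightarrow> wedge_tri {i} {j} {k} = wedge3 i j k"
  by (simp add: wedge_tri_def symbols_closed)

lemma wedge_tri_singleton_alternating: "wedge_tri {i} {i} \<nu> = \<one>\<^sub>Z"
  unfolding wedge_tri_def by (rule Z.finprod_one_eqI) (auto simp: wedge3_def)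

text \<open>Expand by trilinearity after splitting off one index: the two diagonal terms vanish, and
  the two cross terms are equal by symmetry and cancel.\<close>

lemma wedge_tri_alternating:
  assumes "\<sigma> \<in> VV" "\<nu> \<in> VV"
  shows "wedge_tri \<sigma> \<sigma> \<nu> = \<one>\<^sub>Z"
proof -
  have "finite \<sigma>" "\<sigma> \<subseteq> {1..}"
    using assms by (auto simp: V_carrier)
  then show ?thesis
  proof (induction \<sigma> rule: finite_induct)
    case (insert i \<sigma>)
    have V: "{i} \<in> VV" "\<sigma> \<in> VV"
      using insert by (auto simp: V_carrier)
    have eq: "insert i \<sigma> = sym_diff {i} \<sigma>"
      using insert by auto
    have *: "wedge_tri \<tau> (sym_diff {i} \<sigma>) \<nu> = wedge_tri \<tau> {i} \<nu> \<odot> wedge_tri \<tau> \<sigma> \<nu>" if "\<tau> \<in> VV" for \<tau>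
      using V that assms wedge_tri_swap_left[of \<tau> _ \<nu>] by (simp add: wedge_tri_sym_diff)
    have "wedge_tri (sym_diff {i} \<sigma>) (sym_diff {i} \<sigma>) \<nu> =
      (wedge_tri {i} {i} \<nu> \<odot> wedge_tri \<sigma> {i} \<nu>) \<odot> (wedge_tri {i} \<sigma> \<nu> \<odot> wedge_tri \<sigma> \<sigma> \<nu>)"
      by (simp only: wedge_tri_sym_diff * V V_closed assms)
    also have "\<dots> = \<one>\<^sub>Z"
      using V insert assms
      by (simp add: wedge_tri_singleton_alternating wedge_tri_swap_left[of \<sigma> "{i}" \<nu>] Z.square_one)
    finally show ?case
      using eq by metis
  qed (simp add: wedge_tri_empty)
qed

lemma F_factor_sym_diff_left:
  assumes "\<sigma> \<in> VV" "\<tau> \<in> VV" "\<mu> \<in> VV"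
  shows "F_factor (sym_diff \<sigma> \<tau>) \<mu> = F_factor \<sigma> \<mu> \<odot> F_factor \<tau> \<mu>"
  using assms
  by (simp add: F_factor_parts bar_part_sym_diff_left pair_part_sym_diff_left
      triple_part_sym_diff_left Z.m_ac)

text \<open>The bar and pair parts are additive here; the extra term comes from the triple part and
  is the source of nonassociativity in \<open>F_loop\<close>.\<close>

lemma F_factor_sym_diff_right:
  assumes "\<sigma> \<in> VV" "\<mu> \<in> VV" "\<nu> \<in> VV"
  shows "F_factor \<sigma> (sym_diff \<mu> \<nu>) = F_factor \<sigma> \<mu> \<odot> F_factor \<sigma> \<nu> \<odot> wedge_tri \<sigma> \<mu> \<nu>"
  using assms
  by (simp add: F_factor_parts bar_part_sym_diff_right pair_part_sym_diff_right
      triple_part_sym_diff_right Z.m_ac)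

lemma F_factor_empty [simp]: "F_factor {} \<mu> = \<one>\<^sub>Z" "F_factor \<mu> {} = \<one>\<^sub>Z"
  by (auto simp: F_factor_parts bar_part_def pair_part_def triple_part_def intro!: Z.finprod_one_eqI)

lemma F_factor_singletons:
  assumes "i \<ge> 1" "k \<ge> 1"
  shows "F_factor {i} {k} = (if i = k then bar_sym k else if i > k then wedge2 i k else \<one>\<^sub>Z)"
proof -
  have "pair_part {i} {k} = (if i > k then wedge2 i k else \<one>\<^sub>Z)"
  proof -
    have "{(i', j). i' \<in> {i} \<and> j \<in> {k} \<and> i' > j} = (if i > k then {(i, k)} else {})"
      by auto
    then show ?thesis
      using assms unfolding pair_part_def by (simp only:) (simp add: symbols_closed)
  qed
  moreover have "triple_part {i} {k} = \<one>\<^sub>Z"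
    unfolding triple_part_def by (rule Z.finprod_one_eqI) auto
  moreover have "bar_part {i} {k} = (if i = k then bar_sym k else \<one>\<^sub>Z)"
    using assms by (auto simp: bar_part_def symbols_closed)
  ultimately show ?thesis
    using assms by (simp add: F_factor_parts symbols_closed)
qed

section \<open>Membership of \<open>\<F>\<close> in the variety\<close>

text \<open>Each defining identity says that a square, commutator or associator has square
  \<open>\<one>\<close>, or commutes or associates with everything. Centrality gives them all at
  once.\<close>

lemma (in moufang_loop) variety_EI:
  assumes sq: "\<And>x. x \<in> carrier G \<Longrightarrow> x \<otimes> x \<in> central_invol G"
    and cm: "\<And>x y. \<lbrakk>x \<in> carrier G; y \<in> carrier G\<rbrakk> \<Longrightarrow> loop_commutator G x y \<in> central_invol G"
    and as: "\<And>x y z. \<lbrakk>x \<in> carrier G; y \<in> carrier G; z \<in> carrier G\<rbrakk>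
      \<Longrightarrow> loop_associator G x y z \<in> central_invol G"
  shows "variety_E G"
proof -
  have c_com: "loop_commutator G c t = \<one>" if "c \<in> central_invol G" "t \<in> carrier G" for c t
  proof (rule left_cancel[of "t \<otimes> c"])
    show "(t \<otimes> c) \<otimes> loop_commutator G c t = (t \<otimes> c) \<otimes> \<one>"
      using commutator_eq[of c t] central_comm[of c t] that by simp
  qed (use that in auto)
  have c_asc: "loop_associator G c y z = \<one>" if "c \<in> central_invol G" "y \<in> carrier G" "z \<in> carrier G" for c y z
  proof (rule right_cancel[of "c \<otimes> (y \<otimes> z)"])
    show "loop_associator G c y z \<otimes> (c \<otimes> (y \<otimes> z)) = \<one> \<otimes> (c \<otimes> (y \<otimes> z))"
      using associator_eq[of c y z] central_assoc1[of c y z] that by simp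
  qed (use that in auto)
  show ?thesis
  proof
    fix x assume x: "x \<in> carrier G"
    have "((x \<otimes> x) \<otimes> x) \<otimes> x = \<one>"
      using central_assoc1[OF sq[OF x] x x] central_square[OF sq[OF x]] by simp
    then show "x [^] (4::nat) = \<one>"
      using x by (simp add: pow_four)
  qed (auto simp: pow_two central_square sq cm as c_com c_asc)
qed

lemma F_carrier: "carrier F_loop = VV \<times> ZZ"
  by (simp add: F_loop_def)

lemma F_mult:
  "(\<sigma>, z) \<otimes>\<^bsub>F_loop\<^esub> (\<mu>, w) = (sym_diff \<sigma> \<mu>, F_factor \<sigma> \<mu> \<odot> z \<odot> w)"
  by (simp add: F_loop_def V_mult)

lemma F_one: "\<one>\<^bsub>F_loop\<^esub> = ({}, \<one>\<^sub>Z)"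
  by (simp add: F_loop_def V_one)

lemma alg_loop_F: "alg_loop F_loop"
proof
  fix a b assume "a \<in> carrier F_loop" "b \<in> carrier F_loop"
  then obtain \<sigma> z \<tau> w where ab: "a = (\<sigma>, z)" "b = (\<tau>, w)" and
    V: "\<sigma> \<in> VV" "\<tau> \<in> VV" and Z: "z \<in> ZZ" "w \<in> ZZ"
    by (auto simp: F_carrier)
  show "\<exists>!x. x \<in> carrier F_loop \<and> a \<otimes>\<^bsub>F_loop\<^esub> x = b"
  \<comment> \<open>The first component is forced by the equation in \<open>V_grp\<close>; the
    second is then solved for in \<open>Z_grp\<close>, where every element is its own
    inverse.\<close>
  proof (rule ex1I[of _ "(sym_diff \<sigma> \<tau>, F_factor \<sigma> (sym_diff \<sigma> \<tau>) \<odot> z \<odot> w)"])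
    fix x assume x: "x \<in> carrier F_loop \<and> a \<otimes>\<^bsub>F_loop\<^esub> x = b"
    then obtain \<mu> v where \<mu>: "x = (\<mu>, v)" "\<mu> \<in> VV" "v \<in> ZZ"
      by (auto simp: F_carrier)
    have "sym_diff \<sigma> \<mu> = \<tau>" "F_factor \<sigma> \<mu> \<odot> z \<odot> v = w"
      using x by (auto simp: \<mu> ab F_mult)
    moreover from this have "\<mu> = sym_diff \<sigma> \<tau>"
      by auto
    ultimately show "x = (sym_diff \<sigma> \<tau>, F_factor \<sigma> (sym_diff \<sigma> \<tau>) \<odot> z \<odot> w)"
      using \<mu> V Z by (auto simp: Z.ac_simps2)
  qed (use V Z in \<open>auto simp: ab F_carrier F_mult Z.ac_simps2\<close>)
  show "\<exists>!y. y \<in> carrier F_loop \<and> y \<otimes>\<^bsub>F_loop\<^esub> a = b"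
  proof (rule ex1I[of _ "(sym_diff \<tau> \<sigma>, F_factor (sym_diff \<tau> \<sigma>) \<sigma> \<odot> z \<odot> w)"])
    fix x assume x: "x \<in> carrier F_loop \<and> x \<otimes>\<^bsub>F_loop\<^esub> a = b"
    then obtain \<mu> v where \<mu>: "x = (\<mu>, v)" "\<mu> \<in> VV" "v \<in> ZZ"
      by (auto simp: F_carrier)
    have "sym_diff \<mu> \<sigma> = \<tau>" "F_factor \<mu> \<sigma> \<odot> v \<odot> z = w"
      using x by (auto simp: \<mu> ab F_mult)
    moreover from this have "\<mu> = sym_diff \<tau> \<sigma>"
      by auto
    ultimately show "x = (sym_diff \<tau> \<sigma>, F_factor (sym_diff \<tau> \<sigma>) \<sigma> \<odot> z \<odot> w)"
      using \<mu> V Z by (auto simp: Z.ac_simps2)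
  qed (use V Z in \<open>auto simp: ab F_carrier F_mult Z.ac_simps2\<close>)
qed (auto simp: F_carrier F_mult F_one)

text \<open>Expanding the cocycle gives the same six values of \<open>F_factor\<close> on both sides
  and one trilinear term each. On the left, \<open>wedge_tri \<sigma> \<nu> \<sigma>\<close>
  vanishes by alternation and \<open>wedge_tri \<mu> \<nu> \<sigma>\<close> is the right-hand term
  by symmetry.\<close>

lemma moufang_loop_F: "moufang_loop F_loop"
proof -
  interpret alg_loop F_loop by (rule alg_loop_F)
  show ?thesis
  proof
    fix x y z assume "x \<in> carrier F_loop" "y \<in> carrier F_loop" "z \<in> carrier F_loop"
    then obtain \<sigma> a \<mu> b \<nu> c where xyz: "x = (\<sigma>, a)" "y = (\<mu>, b)" "z = (\<nu>, c)"
      and V: "\<sigma> \<in> VV" "\<mu> \<in> VV" "\<nu> \<in> VV" and Z: "a \<in> ZZ" "b \<in> ZZ" "c \<in> ZZ"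
      by (auto simp: F_carrier)
    have tri: "wedge_tri \<sigma> \<nu> \<sigma> = \<one>\<^sub>Z" "wedge_tri \<mu> \<nu> \<sigma> = wedge_tri \<sigma> \<mu> \<nu>"
      using V wedge_tri_swap_right[of \<sigma> \<nu> \<sigma>] wedge_tri_alternating[of \<sigma> \<nu>]
        wedge_tri_swap_right[of \<mu> \<nu> \<sigma>] wedge_tri_swap_left[of \<mu> \<sigma> \<nu>] by auto
    have 1: "F_factor (sym_diff \<sigma> \<mu>) (sym_diff \<nu> \<sigma>) =
        (F_factor \<sigma> \<nu> \<odot> F_factor \<sigma> \<sigma>) \<odot> (F_factor \<mu> \<nu> \<odot> F_factor \<mu> \<sigma> \<odot> wedge_tri \<sigma> \<mu> \<nu>)"
      using V by (simp add: F_factor_sym_diff_left F_factor_sym_diff_right wedge_tri_sym_diff tri Z.m_ac)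
    have 2: "F_factor (sym_diff \<sigma> (sym_diff \<mu> \<nu>)) \<sigma> = F_factor \<sigma> \<sigma> \<odot> (F_factor \<mu> \<sigma> \<odot> F_factor \<nu> \<sigma>)"
      using V by (simp only: F_factor_sym_diff_left V_closed)
    have 3: "F_factor \<sigma> (sym_diff \<mu> \<nu>) = F_factor \<sigma> \<mu> \<odot> F_factor \<sigma> \<nu> \<odot> wedge_tri \<sigma> \<mu> \<nu>"
      using V by (rule F_factor_sym_diff_right)
    have 4: "sym_diff (sym_diff \<sigma> \<mu>) (sym_diff \<nu> \<sigma>) = sym_diff (sym_diff \<sigma> (sym_diff \<mu> \<nu>)) \<sigma>"
      by blast
    show "(x \<otimes>\<^bsub>F_loop\<^esub> y) \<otimes>\<^bsub>F_loop\<^esub> (z \<otimes>\<^bsub>F_loop\<^esub> x) =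
        (x \<otimes>\<^bsub>F_loop\<^esub> (y \<otimes>\<^bsub>F_loop\<^esub> z)) \<otimes>\<^bsub>F_loop\<^esub> x"
      unfolding xyz F_mult 1 2 3 4 using V Z by (simp add: Z.m_ac)
  qed
qed

lemma fst_F_mult: "fst (x \<otimes>\<^bsub>F_loop\<^esub> y) = sym_diff (fst x) (fst y)"
  by (cases x; cases y) (simp add: F_mult)

lemma central_invol_F:
  assumes "x \<in> carrier F_loop" "fst x = {}"
  shows "x \<in> central_invol F_loop"
  using assms by (auto simp: central_invol_def F_carrier F_mult F_one Z.ac_simps2)

text \<open>The first component is a homomorphism onto the elementary abelian group
  \<open>V_grp\<close>, so it kills squares, commutators and associators; its kernel consists of
  central involutions.\<close>

lemma variety_E_F: "variety_E F_loop"
proof -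
  interpret moufang_loop F_loop by (rule moufang_loop_F)
  have fst_inv: "fst (inv\<^bsub>F_loop\<^esub> x) = fst x" if "x \<in> carrier F_loop" for x
  proof -
    have "sym_diff (fst x) (fst (inv\<^bsub>F_loop\<^esub> x)) = {}"
      using right_inv[OF that] fst_F_mult[of x "inv\<^bsub>F_loop\<^esub> x"] by (simp add: F_one)
    then show ?thesis
      by blast
  qed
  show ?thesis
  proof (rule variety_EI; rule central_invol_F)
    fix x y z assume "x \<in> carrier F_loop" "y \<in> carrier F_loop" "z \<in> carrier F_loop"
    then show "fst (loop_associator F_loop x y z) = {}"
      unfolding loop_associator_def by (auto simp: fst_F_mult fst_inv)
  next
    fix x y assume "x \<in> carrier F_loop" "y \<in> carrier F_loop"
    then show "fst (loop_commutator F_loop x y) = {}"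
      unfolding loop_commutator_def by (auto simp: fst_F_mult fst_inv)
  qed (auto simp: fst_F_mult)
qed

section \<open>Subloops\<close>

lemma subloopD:
  assumes "subloop H G"
  shows "H \<subseteq> carrier G" "alg_loop (G\<lparr>carrier := H\<rparr>)"
  using assms by (auto simp: subloop_def)

context alg_loop
begin

lemma subloopI:
  assumes "H \<subseteq> carrier G" "\<one> \<in> H" "\<And>x y. \<lbrakk>x \<in> H; y \<in> H\<rbrakk> \<Longrightarrow> x \<otimes> y \<in> H"
    and "\<And>a x. \<lbrakk>a \<in> H; x \<in> carrier G; a \<otimes> x \<in> H\<rbrakk> \<Longrightarrow> x \<in> H"
    and "\<And>a x. \<lbrakk>a \<in> H; x \<in> carrier G; x \<otimes> a \<in> H\<rbrakk> \<Longrightarrow> x \<in> H"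
  shows "subloop H G"
  unfolding subloop_def
proof
  show "alg_loop (G\<lparr>carrier := H\<rparr>)"
  proof
    fix a b assume "a \<in> carrier (G\<lparr>carrier := H\<rparr>)" "b \<in> carrier (G\<lparr>carrier := H\<rparr>)"
    then have ab: "a \<in> H" "b \<in> H" "a \<in> carrier G" "b \<in> carrier G"
      using assms(1) by auto
    have "\<exists>!x. x \<in> H \<and> a \<otimes> x = b"
      using left_division[OF ab(3,4)] assms(1,4) ab(1,2) by (metis subsetD)
    then show "\<exists>!x. x \<in> carrier (G\<lparr>carrier := H\<rparr>) \<and> a \<otimes>\<^bsub>G\<lparr>carrier := H\<rparr>\<^esub> x = b"
      by simp
    have "\<exists>!x. x \<in> H \<and> x \<otimes> a = b"
      using right_division[OF ab(3,4)] assms(1,5) ab(1,2) by (metis subsetD)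
    then show "\<exists>!x. x \<in> carrier (G\<lparr>carrier := H\<rparr>) \<and> x \<otimes>\<^bsub>G\<lparr>carrier := H\<rparr>\<^esub> a = b"
      by simp
  qed (use assms(1-3) in auto)
qed fact

lemma subloop_one:
  assumes "subloop H G"
  shows "\<one> \<in> H"
  using alg_loop.unit_closed[OF subloopD(2)[OF assms]] by simp

lemma subloop_mult:
  assumes "subloop H G" "x \<in> H" "y \<in> H"
  shows "x \<otimes> y \<in> H"
  using alg_loop.mult_closed[OF subloopD(2)[OF assms(1)]] assms by simp

lemma subloop_left_division:
  assumes "subloop H G" "a \<in> H" "x \<in> carrier G" "a \<otimes> x \<in> H"
  shows "x \<in> H"
proof -
  obtain x' where "x' \<in> H" "a \<otimes> x' = a \<otimes> x"
    using alg_loop.left_division[OF subloopD(2)[OF assms(1)], of a "a \<otimes> x"] assms by auto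
  then show ?thesis
    using left_cancel[of a x' x] subloopD(1)[OF assms(1)] assms by auto
qed

lemma subloop_right_division:
  assumes "subloop H G" "a \<in> H" "x \<in> carrier G" "x \<otimes> a \<in> H"
  shows "x \<in> H"
proof -
  obtain x' where "x' \<in> H" "x' \<otimes> a = x \<otimes> a"
    using alg_loop.right_division[OF subloopD(2)[OF assms(1)], of a "x \<otimes> a"] assms by auto
  then show ?thesis
    using right_cancel[of a x' x] subloopD(1)[OF assms(1)] assms by auto
qed

lemma subloop_carrier: "subloop (carrier G) G"
  by (rule subloopI) auto

lemma subloop_generated_subloop:
  assumes "S \<subseteq> carrier G"
  shows "subloop (subloop_generated G S) G"
proof (rule subloopI)
  show "subloop_generated G S \<subseteq> carrier G"
    using assms subloop_carrier unfolding subloop_generated_def by auto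
  show "\<one> \<in> subloop_generated G S"
    by (simp add: subloop_generated_def subloop_one)
next
  fix x y assume "x \<in> subloop_generated G S" "y \<in> subloop_generated G S"
  then show "x \<otimes> y \<in> subloop_generated G S"
    by (simp add: subloop_generated_def subloop_mult)
next
  fix a x assume *: "a \<in> subloop_generated G S" "x \<in> carrier G"
  show "x \<in> subloop_generated G S" if "a \<otimes> x \<in> subloop_generated G S"
    using * that subloop_left_division[of _ a x] by (simp add: subloop_generated_def)
  show "x \<in> subloop_generated G S" if "x \<otimes> a \<in> subloop_generated G S"
    using * that subloop_right_division[of _ a x] by (simp add: subloop_generated_def)
qed

text \<open>A subloop of the subloop \<open>H\<close> is a subloop of \<open>G\<close>, so it cannot
  contain \<open>S\<close> without containing \<open>H\<close>.\<close>

lemma subloop_generated_restrict: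
  assumes "S \<subseteq> carrier G"
  defines "H \<equiv> subloop_generated G S"
  shows "subloop_generated (G\<lparr>carrier := H\<rparr>) S = H"
proof
  have H: "subloop H G" "S \<subseteq> H"
    using subloop_generated_subloop[OF assms(1)] by (auto simp: H_def subloop_generated_def)
  then have "subloop H (G\<lparr>carrier := H\<rparr>)"
    by (simp add: subloop_def)
  then show "subloop_generated (G\<lparr>carrier := H\<rparr>) S \<subseteq> H"
    using H(2) by (auto simp: subloop_generated_def[of "G\<lparr>carrier := H\<rparr>"])
  have "H \<subseteq> H'" if "subloop H' (G\<lparr>carrier := H\<rparr>)" "S \<subseteq> H'" for H'
  proof -
    have "subloop H' G"
      using that(1) subloopD(1)[OF H(1)] by (auto simp: subloop_def)
    then show ?thesis
      using that(2) by (auto simp: H_def subloop_generated_def)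
  qed
  then show "H \<subseteq> subloop_generated (G\<lparr>carrier := H\<rparr>) S"
    by (auto simp: subloop_generated_def[of "G\<lparr>carrier := H\<rparr>"])
qed

end

lemma (in variety_E) variety_E_subloop:
  assumes "subloop H G"
  shows "variety_E (G\<lparr>carrier := H\<rparr>)"
proof -
  let ?H = "G\<lparr>carrier := H\<rparr>"
  have sub: "x \<in> carrier G" if "x \<in> H" for x
    using subloopD(1)[OF assms] that by auto
  interpret H: moufang_loop ?H
    using subloopD(2)[OF assms] moufang sub by (auto simp: moufang_loop_def moufang_loop_axioms_def)
  \<comment> \<open>\<open>m_inv\<close> is a description over the carrier and so must be matched
    separately; commutators and associators of the subloop then agree with those of
    \<open>G\<close>.\<close>
  have inv: "inv\<^bsub>?H\<^esub> x = inv x" if "x \<in> H" for x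
    using H.inv_props[of x] that sub by (intro inv_eqI[symmetric]) simp_all
  have com: "loop_commutator ?H x y = com x y" if "x \<in> H" "y \<in> H" for x y
    using that by (simp add: loop_commutator_def inv)
  have asc: "loop_associator ?H x y z = asc x y z" if "x \<in> H" "y \<in> H" "z \<in> H" for x y z
    using that assms by (simp add: loop_associator_def inv subloop_mult)
  have com_H: "com x y \<in> H" if "x \<in> H" "y \<in> H" for x y
    using H.commutator_closed[of x y] that com by simp
  have asc_H: "asc x y z \<in> H" if "x \<in> H" "y \<in> H" "z \<in> H" for x y z
    using H.associator_closed[of x y z] that asc by simp
  have pow: "x [^]\<^bsub>?H\<^esub> (k::nat) = x [^] k" for x k
    by (simp add: nat_pow_def)
  have sq_H: "x [^] (2::nat) \<in> H" if "x \<in> H" for x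
    using that sub assms by (simp add: pow_two subloop_mult)
  show ?thesis
    by unfold_locales
       (auto simp: pow com asc com_H asc_H sq_H sub pow4 comm_pow2 assoc_pow2 square_comm comm_comm
         assoc_comm square_assoc comm_assoc assoc_assoc)
qed

section \<open>Homomorphisms out of \<open>\<F>\<close>\<close>

locale family_in_variety_E = variety_E +
  fixes g :: "nat \<Rightarrow> 'a"
  assumes g_closed [simp]: "g i \<in> carrier G"
begin

text \<open>Left-normed in increasing order, so adjoining a new largest index is multiplication by
  one generator on the right.\<close>

definition oprod :: "nat set \<Rightarrow> 'a" where
  "oprod \<sigma> = foldl (\<lambda>x i. x \<otimes> g i) \<one> (sorted_list_of_set \<sigma>)"

abbreviation "prodK \<equiv> finprod (G\<lparr>carrier := K\<rparr>)"

text \<open>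
  An unordered pair \<open>p\<close> is read as \<open>(Min p, Max p)\<close> and a triple similarly; the symmetry of
  commutator and associator makes the choice of the order immaterial.
\<close>

definition pair_val :: "nat set \<Rightarrow> 'a" where
  "pair_val p = com (g (Min p)) (g (Max p))"

definition triple_val :: "nat set \<Rightarrow> 'a" where
  "triple_val t = asc (g (Min t)) (g (Min (t - {Min t}))) (g (Max t))"

definition zhom :: "zelem \<Rightarrow> 'a" where
  "zhom = (\<lambda>(A, B, C). prodK (\<lambda>i. g i \<otimes> g i) A \<otimes> (prodK pair_val B \<otimes> prodK triple_val C))"

lemma vals_central [simp]: "pair_val p \<in> K" "triple_val t \<in> K"
  by (simp_all add: pair_val_def triple_val_def)

lemma prodK_closed [simp]:
  "prodK (\<lambda>i. g i \<otimes> g i) A \<in> K" "prodK pair_val B \<in> K" "prodK triple_val C \<in> K"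
  by (rule cen.finprod_closed; simp)+

lemma zhom_central [simp]: "zhom z \<in> K"
  by (cases z) (simp add: zhom_def)

text \<open>Addition in \<open>Z_grp\<close> is symmetric difference in each component, and
  \<open>K\<close> has exponent 2, so repeated factors cancel on both sides.\<close>

lemma zhom_mult:
  assumes "z \<in> ZZ" "w \<in> ZZ"
  shows "zhom (z \<odot> w) = zhom z \<otimes> zhom w"
proof -
  obtain A B C A' B' C' where zw: "z = (A, B, C)" "w = (A', B', C')"
    by (cases z; cases w) auto
  have fin: "finite A" "finite B" "finite C" "finite A'" "finite B'" "finite C'"
    using assms by (auto simp: zw ZZ_iff)
  have eqs: "prodK (\<lambda>i. g i \<otimes> g i) (sym_diff A A') = prodK (\<lambda>i. g i \<otimes> g i) A \<otimes> prodK (\<lambda>i. g i \<otimes> g i) A'"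
    "prodK pair_val (sym_diff B B') = prodK pair_val B \<otimes> prodK pair_val B'"
    "prodK triple_val (sym_diff C C') = prodK triple_val C \<otimes> prodK triple_val C'"
    using fin by (simp_all add: cen.finprod_sym_diff)
  show ?thesis
    unfolding zw Z_mult zhom_def prod.case eqs by (simp add: cen.m_ac)
qed

lemma zhom_one [simp]: "zhom \<one>\<^sub>Z = \<one>"
  by (simp add: zhom_def Z_one)

lemma zhom_bar_sym: "zhom (bar_sym i) = g i \<otimes> g i"
  by (simp add: zhom_def bar_sym_def)

lemma zhom_wedge2: "i > j \<Longrightarrow> zhom (wedge2 i j) = com (g i) (g j)"
  by (simp add: zhom_def wedge2_def pair_val_def commutator_sym[of "g i" "g j"])

lemma zhom_wedge3_sorted:
  assumes "i < j" "j < k"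
  shows "zhom (wedge3 i j k) = asc (g i) (g j) (g k)"
proof -
  have "Min {i, j, k} = i" "Max {i, j, k} = k"
    using assms by auto
  moreover have "{i, j, k} - {i} = {j, k}"
    using assms by auto
  moreover have "Min {j, k} = j"
    using assms by auto
  ultimately have "triple_val {i, j, k} = asc (g i) (g j) (g k)"
    by (simp only: triple_val_def)
  then show ?thesis
    using assms by (simp add: zhom_def wedge3_def)
qed

text \<open>Both sides are symmetric, which reduces distinct indices to increasing ones; both are
  trivial when indices coincide.\<close>

lemma zhom_wedge3: "zhom (wedge3 i j k) = asc (g i) (g j) (g k)"
proof -
  note sw = wedge3_sym(1)[of i j k] wedge3_sym(2)[of i j k] wedge3_sym(2)[of j i k]
    wedge3_sym(1)[of i k j] wedge3_sym(1)[of j k i]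
    associator_swap_left[of "g i" "g j" "g k"] associator_swap_right[of "g i" "g j" "g k"]
    associator_swap_right[of "g j" "g i" "g k"] associator_swap_left[of "g i" "g k" "g j"]
    associator_swap_left[of "g j" "g k" "g i"]
  consider "i = j \<or> i = k \<or> j = k" | "i < j" "j < k" | "j < i" "i < k" | "i < k" "k < j"
    | "j < k" "k < i" | "k < i" "i < j" | "k < j" "j < i"
    by linarith
  then show ?thesis
  proof cases
    case 1
    then show ?thesis
      by (auto simp: wedge3_def associator_repeat associator_repeat_outer)
  next
    case 2 then show ?thesis by (rule zhom_wedge3_sorted)
  next
    case 3 then show ?thesis using zhom_wedge3_sorted[of j i k] sw by simp
  next
    case 4 then show ?thesis using zhom_wedge3_sorted[of i k j] sw by simp
  next
    case 5 then show ?thesis using zhom_wedge3_sorted[of j k i] sw by simp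
  next
    case 6 then show ?thesis using zhom_wedge3_sorted[of k i j] sw by simp
  next
    case 7 then show ?thesis using zhom_wedge3_sorted[of k j i] sw by simp
  qed
qed

section \<open>Multiplication of ordered products\<close>

lemma oprod_empty [simp]: "oprod {} = \<one>"
  by (simp add: oprod_def)

lemma oprod_insert_max:
  assumes "finite \<sigma>" "\<And>i. i \<in> \<sigma> \<Longrightarrow> i < m"
  shows "oprod (insert m \<sigma>) = oprod \<sigma> \<otimes> g m"
proof -
  have "m \<notin> \<sigma>"
    using assms(2) by blast
  then have "sorted_list_of_set (insert m \<sigma>) = insort m (sorted_list_of_set \<sigma>)"
    using assms(1) by simp
  also have "\<dots> = sorted_list_of_set \<sigma> @ [m]"
    using assms by (intro sorted_insort_is_snoc) (auto simp: less_imp_le)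
  finally show ?thesis
    by (simp add: oprod_def)
qed

lemma oprod_closed [simp]: "oprod \<sigma> \<in> carrier G"
proof -
  have "foldl (\<lambda>x i. x \<otimes> g i) a xs \<in> carrier G" if "a \<in> carrier G" for a xs
    using that by (induction xs arbitrary: a) auto
  then show ?thesis
    by (simp add: oprod_def)
qed

text \<open>Adds the largest element last, in step with \<open>oprod_insert_max\<close>. The
  equation \<open>insert m \<sigma> = sym_diff \<sigma> {m}\<close> is supplied for the additivity
  laws.\<close>

lemma VV_max_induct [consumes 1, case_names empty insert]:
  assumes "\<sigma> \<in> VV" "P {}"
    and "\<And>m \<sigma>. \<lbrakk>\<sigma> \<in> VV; {m} \<in> VV; m \<ge> 1; \<And>i. i \<in> \<sigma> \<Longrightarrow> i < m; m \<notin> \<sigma>;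
      insert m \<sigma> = sym_diff \<sigma> {m}; P \<sigma>\<rbrakk> \<Longrightarrow> P (insert m \<sigma>)"
  shows "P \<sigma>"
proof -
  have "finite \<sigma>" "\<sigma> \<subseteq> {1..}"
    using assms(1) by (auto simp: V_carrier)
  then show ?thesis
  proof (induction rule: finite_linorder_max_induct)
    case (insert m \<tau>)
    then show ?case
      by (intro assms(3)) (auto simp: V_carrier)
  qed (rule assms(2))
qed

text \<open>Both sides are additive in the first argument, so singletons decide. The other two
  arguments are left abstract, so that the lemma can be applied to one slot after another.\<close>

lemma zhom_wedge_tri_aux:
  assumes "\<sigma> \<in> VV" "u \<in> carrier G" "v \<in> carrier G" "\<mu> \<in> VV" "\<nu> \<in> VV"
    and single: "\<And>i. i \<ge> 1 \<Longrightarrow> zhom (wedge_tri {i} \<mu> \<nu>) = asc (g i) u v"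
  shows "zhom (wedge_tri \<sigma> \<mu> \<nu>) = asc (oprod \<sigma>) u v"
  using assms(1)
proof (induction rule: VV_max_induct)
  case (insert m \<sigma>)
  have "zhom (wedge_tri (insert m \<sigma>) \<mu> \<nu>) = zhom (wedge_tri \<sigma> \<mu> \<nu>) \<otimes> zhom (wedge_tri {m} \<mu> \<nu>)"
    unfolding insert(6) using insert(1,2) assms by (simp add: wedge_tri_sym_diff zhom_mult)
  also have "\<dots> = asc (oprod (insert m \<sigma>)) u v"
    using insert(1,3,4,7) assms(2,3) by (simp add: single oprod_insert_max associator_mult)
  finally show ?case .
qed (use assms in \<open>simp add: wedge_tri_empty associator_central_one\<close>)

text \<open>Two slots are extended from generators in turn, with a swap in between. The third stays
  a single generator, since products are built one generator at a time.\<close>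

lemma zhom_wedge_tri:
  assumes "\<sigma> \<in> VV" "\<mu> \<in> VV" "{k} \<in> VV"
  shows "zhom (wedge_tri \<sigma> \<mu> {k}) = asc (oprod \<sigma>) (oprod \<mu>) (g k)"
proof -
  have k: "k \<ge> 1"
    using assms by (auto simp: V_carrier)
  have V1: "{i} \<in> VV" if "i \<ge> 1" for i
    using that by (simp add: V_carrier)
  have 1: "zhom (wedge_tri \<tau> {i} {k}) = asc (oprod \<tau>) (g i) (g k)" if "\<tau> \<in> VV" "i \<ge> 1" for i \<tau>
    using that k V1 by (intro zhom_wedge_tri_aux) (auto simp: wedge_tri_singletons zhom_wedge3)
  have "zhom (wedge_tri \<mu> \<sigma> {k}) = asc (oprod \<mu>) (oprod \<sigma>) (g k)"
  proof (rule zhom_wedge_tri_aux)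
    fix i :: nat assume i: "i \<ge> 1"
    show "zhom (wedge_tri {i} \<sigma> {k}) = asc (g i) (oprod \<sigma>) (g k)"
      using 1[OF assms(1) i] wedge_tri_swap_left[of "{i}" \<sigma> "{k}"] V1[OF i] assms
        associator_swap_left[of "g i" "oprod \<sigma>" "g k"] by simp
  qed (use assms in auto)
  then show ?thesis
    using wedge_tri_swap_left[OF assms] associator_swap_left[of "oprod \<mu>" "oprod \<sigma>" "g k"] by simp
qed

lemma F_factor_below:
  assumes "\<sigma> \<in> VV" "k \<ge> 1" "\<And>i. i \<in> \<sigma> \<Longrightarrow> i < k"
  shows "F_factor \<sigma> {k} = \<one>\<^sub>Z"
  using assms(1,3)
proof (induction rule: VV_max_induct)
  case (insert m \<sigma>)
  have "{k} \<in> VV"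
    using assms(2) by (simp add: V_carrier)
  then have "F_factor (insert m \<sigma>) {k} = F_factor \<sigma> {k} \<odot> F_factor {m} {k}"
    unfolding insert(6) using insert(1,2) by (intro F_factor_sym_diff_left)
  moreover have "m < k" "F_factor \<sigma> {k} = \<one>\<^sub>Z"
    using insert by auto
  ultimately show ?case
    using F_factor_singletons[OF insert(3) assms(2)] by simp
qed simp

text \<open>The new \<open>g k\<close> travels left past all larger generators, each of which costs
  a commutator. If it meets its own copy, the two merge into a central square; otherwise it settles
  in its place.\<close>

lemma oprod_mult_gen:
  assumes "\<tau> \<in> VV" "{k} \<in> VV"
  shows "oprod \<tau> \<otimes> g k = zhom (F_factor \<tau> {k}) \<otimes> oprod (sym_diff \<tau> {k})"
  using assms(1)
proof (induction rule: VV_max_induct)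
  case empty
  show ?case
    using oprod_insert_max[of "{}" k] by simp
next
  case (insert m \<tau>)
  have k: "k \<ge> 1"
    using assms(2) by (auto simp: V_carrier)
  have V: "insert m \<tau> \<in> VV"
    using insert(1,3) by (auto simp: V_carrier)
  have fin: "finite \<tau>"
    using insert(1) by simp
  have oprod_m: "oprod (insert m \<tau>) = oprod \<tau> \<otimes> g m"
    using fin insert(4) by (rule oprod_insert_max)
  have factor: "F_factor (insert m \<tau>) {k} = F_factor \<tau> {k} \<odot> F_factor {m} {k}"
    unfolding insert(6) using insert(1,2) assms(2) by (intro F_factor_sym_diff_left)
  consider "m < k" | "m = k" | "k < m"
    by linarith
  then show ?case
  proof cases
    case 1
    then have below: "i < k" if "i \<in> insert m \<tau>" for i
      using that insert(4)[of i] by (metis insert_iff less_trans)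
    have "sym_diff (insert m \<tau>) {k} = insert k (insert m \<tau>)"
      using below by blast
    moreover have "oprod (insert k (insert m \<tau>)) = oprod (insert m \<tau>) \<otimes> g k"
      using fin below by (intro oprod_insert_max) auto
    moreover have "F_factor (insert m \<tau>) {k} = \<one>\<^sub>Z"
      using V k below by (rule F_factor_below)
    ultimately show ?thesis
      by simp
  next
    case 2
    have "F_factor (insert m \<tau>) {k} = bar_sym k"
      using factor F_factor_singletons[OF insert(3) k] F_factor_below[OF insert(1) k] insert(4) 2
        symbols_closed(1)[OF k] by simp
    moreover have "sym_diff (insert m \<tau>) {k} = \<tau>"
      using 2 insert(5) by auto
    moreover have "(oprod \<tau> \<otimes> g k) \<otimes> g k = (g k \<otimes> g k) \<otimes> oprod \<tau>"
      using associator_eq[of "oprod \<tau>" "g k" "g k"] central_comm[of "g k \<otimes> g k" "oprod \<tau>"]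
      by (simp add: associator_repeat)
    ultimately show ?thesis
      by (simp add: oprod_m zhom_bar_sym flip: 2)
  next
    case 3
    let ?c = "com (g m) (g k)" and ?a = "asc (oprod \<tau>) (g m) (g k)"
    \<comment> \<open>The associator released by rebracketing is symmetric in \<open>g m\<close> and
      \<open>g k\<close>, so it is absorbed when the bracket is moved back after the swap. Only the
      commutator survives.\<close>
    have "(oprod \<tau> \<otimes> g m) \<otimes> g k = ?a \<otimes> (oprod \<tau> \<otimes> (?c \<otimes> (g k \<otimes> g m)))"
      using associator_eq[of "oprod \<tau>" "g m" "g k"] mult_swap[of "g m" "g k"] by simp
    also have "\<dots> = ?c \<otimes> (?a \<otimes> (oprod \<tau> \<otimes> (g k \<otimes> g m)))"
      by (simp add: central_assoc2[of ?c])
    also have "\<dots> = ?c \<otimes> ((oprod \<tau> \<otimes> g k) \<otimes> g m)"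
      using associator_eq[of "oprod \<tau>" "g k" "g m"] associator_swap_right[of "oprod \<tau>" "g k" "g m"]
      by simp
    also have "\<dots> = ?c \<otimes> (zhom (F_factor \<tau> {k}) \<otimes> (oprod (sym_diff \<tau> {k}) \<otimes> g m))"
      by (simp add: insert(7) central_assoc1)
    also have "\<dots> = (zhom (F_factor \<tau> {k}) \<otimes> ?c) \<otimes> (oprod (sym_diff \<tau> {k}) \<otimes> g m)"
      by (simp add: central_assoc1 central_assoc2[of ?c "zhom (F_factor \<tau> {k})"])
    also have "oprod (sym_diff \<tau> {k}) \<otimes> g m = oprod (insert m (sym_diff \<tau> {k}))"
      using fin insert(4) 3 by (intro oprod_insert_max[symmetric]) auto
    also have "insert m (sym_diff \<tau> {k}) = sym_diff (insert m \<tau>) {k}"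
      using 3 by auto
    also have "zhom (F_factor \<tau> {k}) \<otimes> ?c = zhom (F_factor (insert m \<tau>) {k})"
      using F_factor_singletons[OF insert(3) k] 3 insert(1,3) k assms(2)
      by (simp add: factor zhom_mult symbols_closed zhom_wedge2)
    finally show ?thesis
      by (simp add: oprod_m)
  qed
qed

text \<open>Induction on the largest index \<open>k\<close> of the right factor. Rebracketing to
  free \<open>g k\<close> costs an associator, which is exactly the image of the polarization term
  \<open>wedge_tri \<sigma> \<mu> {k}\<close>.\<close>

lemma oprod_mult:
  assumes "\<sigma> \<in> VV" "\<mu> \<in> VV"
  shows "oprod \<sigma> \<otimes> oprod \<mu> = zhom (F_factor \<sigma> \<mu>) \<otimes> oprod (sym_diff \<sigma> \<mu>)"
  using assms(2)
proof (induction rule: VV_max_induct)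
  case (insert k \<mu>)
  let ?a = "asc (oprod \<sigma>) (oprod \<mu>) (g k)" and ?f = "\<lambda>\<sigma> \<mu>. zhom (F_factor \<sigma> \<mu>)"
  let ?\<tau> = "sym_diff \<sigma> \<mu>"
  have \<tau>: "?\<tau> \<in> VV"
    using assms(1) insert(1) by simp
  have fin: "finite \<mu>"
    using insert(1) by simp
  have "(oprod \<sigma> \<otimes> oprod \<mu>) \<otimes> g k = ?a \<otimes> (oprod \<sigma> \<otimes> (oprod \<mu> \<otimes> g k))"
    by (rule associator_eq) auto
  then have "oprod \<sigma> \<otimes> (oprod \<mu> \<otimes> g k) = ?a \<otimes> ((oprod \<sigma> \<otimes> oprod \<mu>) \<otimes> g k)"
    using central_cancel[of ?a "oprod \<sigma> \<otimes> (oprod \<mu> \<otimes> g k)"] by simp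
  also have "\<dots> = ?a \<otimes> (?f \<sigma> \<mu> \<otimes> (oprod ?\<tau> \<otimes> g k))"
    by (simp add: insert(7) central_assoc1)
  also have "\<dots> = ?a \<otimes> (?f \<sigma> \<mu> \<otimes> (?f ?\<tau> {k} \<otimes> oprod (sym_diff ?\<tau> {k})))"
    using oprod_mult_gen[OF \<tau> insert(2)] by simp
  also have "\<dots> = (?a \<otimes> (?f \<sigma> \<mu> \<otimes> ?f ?\<tau> {k})) \<otimes> oprod (sym_diff ?\<tau> {k})"
    by (simp add: central_assoc1)
  \<comment> \<open>All indices of \<open>\<mu>\<close> lie below \<open>k\<close>, so
    \<open>\<mu>\<close> contributes nothing to the cost of placing \<open>g k\<close>.\<close>
  also have "F_factor ?\<tau> {k} = F_factor \<sigma> {k}"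
    using F_factor_sym_diff_left[OF assms(1) insert(1,2)] F_factor_below[OF insert(1,3,4)]
      assms(1) insert(2) by simp
  also have "?a \<otimes> (?f \<sigma> \<mu> \<otimes> ?f \<sigma> {k}) = ?f \<sigma> \<mu> \<otimes> ?f \<sigma> {k} \<otimes> ?a"
    by (simp add: cen.m_ac)
  also have "\<dots> = ?f \<sigma> (insert k \<mu>)"
    unfolding insert(6) using assms(1) insert(1,2)
    by (simp add: F_factor_sym_diff_right zhom_mult zhom_wedge_tri)
  also have "sym_diff ?\<tau> {k} = sym_diff \<sigma> (insert k \<mu>)"
    using insert(5) by blast
  also have "oprod \<mu> \<otimes> g k = oprod (insert k \<mu>)"
    using fin insert(4) by (rule oprod_insert_max[symmetric])
  finally show ?case .
qed simp

definition F_hom :: "nat set \<times> zelem \<Rightarrow> 'a" where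
  "F_hom = (\<lambda>(\<sigma>, z). zhom z \<otimes> oprod \<sigma>)"

lemma F_hom_mult:
  assumes "x \<in> carrier F_loop" "y \<in> carrier F_loop"
  shows "F_hom (x \<otimes>\<^bsub>F_loop\<^esub> y) = F_hom x \<otimes> F_hom y"
proof -
  obtain \<sigma> z \<mu> w where xy: "x = (\<sigma>, z)" "y = (\<mu>, w)"
    and V: "\<sigma> \<in> VV" "\<mu> \<in> VV" and Z: "z \<in> ZZ" "w \<in> ZZ"
    using assms by (auto simp: F_carrier)
  have "F_hom x \<otimes> F_hom y = zhom z \<otimes> (oprod \<sigma> \<otimes> (zhom w \<otimes> oprod \<mu>))"
    by (simp add: xy F_hom_def central_assoc1)
  also have "\<dots> = zhom z \<otimes> (zhom w \<otimes> (zhom (F_factor \<sigma> \<mu>) \<otimes> oprod (sym_diff \<sigma> \<mu>)))"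
    using oprod_mult[OF V] by (simp add: central_assoc2[of "zhom w" "oprod \<sigma>"])
  also have "\<dots> = (zhom z \<otimes> (zhom w \<otimes> zhom (F_factor \<sigma> \<mu>))) \<otimes> oprod (sym_diff \<sigma> \<mu>)"
    by (simp add: central_assoc1)
  also have "zhom z \<otimes> (zhom w \<otimes> zhom (F_factor \<sigma> \<mu>)) = zhom (F_factor \<sigma> \<mu> \<odot> z \<odot> w)"
    using V Z by (simp add: zhom_mult cen.m_ac)
  finally show ?thesis
    by (simp add: xy F_hom_def F_mult)
qed

lemma F_hom_closed [simp]: "F_hom x \<in> carrier G"
  by (cases x) (simp add: F_hom_def)

lemma F_hom_gen: "F_hom (F_gen i) = g i"
  using oprod_insert_max[of "{}" i] by (simp add: F_hom_def F_gen_def)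

end

section \<open>Uniqueness of extensions and freeness\<close>

lemma hom_agree_on_generated:
  assumes G: "alg_loop G" and L: "alg_loop L" and S: "S \<subseteq> carrier G"
    and h: "h \<in> hom G L" "h' \<in> hom G L" and eq: "\<And>x. x \<in> S \<Longrightarrow> h x = h' x"
    and x: "x \<in> subloop_generated G S"
  shows "h x = h' x"
proof -
  interpret G: alg_loop G by fact
  interpret L: alg_loop L by fact
  have cl: "h x \<in> carrier L" "h' x \<in> carrier L" if "x \<in> carrier G" for x
    using h that by (auto simp: hom_def)
  have mult: "h (x \<otimes>\<^bsub>G\<^esub> y) = h x \<otimes>\<^bsub>L\<^esub> h y" "h' (x \<otimes>\<^bsub>G\<^esub> y) = h' x \<otimes>\<^bsub>L\<^esub> h' y"
    if "x \<in> carrier G" "y \<in> carrier G" for x y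
    using h that by (auto simp: hom_def)
  \<comment> \<open>The image of the unit is idempotent, and cancellation leaves only
    \<open>\<one>\<close> as an idempotent of a loop.\<close>
  have one: "k \<one>\<^bsub>G\<^esub> = \<one>\<^bsub>L\<^esub>" if "k \<in> hom G L" for k
  proof (rule L.left_cancel[of "k \<one>\<^bsub>G\<^esub>"])
    have "k \<one>\<^bsub>G\<^esub> \<in> carrier L"
      using that by (auto simp: hom_def)
    then show "k \<one>\<^bsub>G\<^esub> \<otimes>\<^bsub>L\<^esub> k \<one>\<^bsub>G\<^esub> = k \<one>\<^bsub>G\<^esub> \<otimes>\<^bsub>L\<^esub> \<one>\<^bsub>L\<^esub>"
      using hom_mult[OF that G.unit_closed G.unit_closed] by simp
  qed (use that in \<open>auto simp: hom_def\<close>)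
  \<comment> \<open>The equalizer is closed under both divisions because \<open>L\<close> cancels,
    so it is a subloop containing \<open>S\<close>.\<close>
  let ?Q = "{x \<in> carrier G. h x = h' x}"
  have "subloop ?Q G"
  proof (rule G.subloopI)
    fix a x assume a: "a \<in> ?Q" and x: "x \<in> carrier G"
    show "x \<in> ?Q" if "a \<otimes>\<^bsub>G\<^esub> x \<in> ?Q"
      using a x that L.left_cancel[of "h a" "h x" "h' x"] cl by (simp add: mult)
    show "x \<in> ?Q" if "x \<otimes>\<^bsub>G\<^esub> a \<in> ?Q"
      using a x that L.right_cancel[of "h a" "h x" "h' x"] cl by (simp add: mult)
  qed (use h in \<open>auto simp: mult one\<close>)
  then have "subloop_generated G S \<subseteq> ?Q"
    using S eq unfolding subloop_generated_def by blast
  then show ?thesis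
    using x by auto
qed

theorem theorem2:
  fixes n :: nat
  shows "free_basis_E TYPE('b) (Fn_loop n) (F_gen ` {1..n}) \<and> card (F_gen ` {1..n}) = n"
proof
  let ?X = "F_gen ` {1..n}"
  interpret F: variety_E F_loop by (rule variety_E_F)
  have X: "?X \<subseteq> carrier F_loop"
    by (auto simp: F_gen_def F_carrier V_carrier)
  have sub: "subloop (carrier (Fn_loop n)) F_loop"
    using F.subloop_generated_subloop[OF X] by (simp add: Fn_loop_def)
  have E: "variety_E (Fn_loop n)"
    using F.variety_E_subloop[OF sub] by (simp add: Fn_loop_def)
  then interpret Fn: variety_E "Fn_loop n" .
  have XFn: "?X \<subseteq> carrier (Fn_loop n)"
    by (auto simp: Fn_loop_def subloop_generated_def)
  have gen: "subloop_generated (Fn_loop n) ?X = carrier (Fn_loop n)"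
    using F.subloop_generated_restrict[OF X] by (simp add: Fn_loop_def)
  have inj: "inj_on F_gen A" for A
    by (auto simp: inj_on_def F_gen_def)
  show "card ?X = n"
    using card_image[OF inj, of "{1..n}"] by simp
  have "\<exists>h \<in> hom (Fn_loop n) L. (\<forall>x\<in>?X. h x = f x) \<and>
      (\<forall>h' \<in> hom (Fn_loop n) L. (\<forall>x\<in>?X. h' x = f x) \<longrightarrow> (\<forall>x\<in>carrier (Fn_loop n). h' x = h x))"
    if L: "variety_E L" and f: "f \<in> ?X \<rightarrow> carrier L" for L :: "'b monoid" and f
  proof -
    interpret L: variety_E L by fact
    \<comment> \<open>\<open>F_hom\<close> lives on all of \<open>F_loop\<close> and needs a value
      at every index; indices outside \<open>{1..n}\<close> are sent to the unit.\<close>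
    define g where "g i = (if i \<in> {1..n} then f (F_gen i) else \<one>\<^bsub>L\<^esub>)" for i
    interpret g: family_in_variety_E L g
      by unfold_locales (use f in \<open>auto simp: g_def\<close>)
    have hom: "g.F_hom \<in> hom (Fn_loop n) L"
    proof -
      have "mult (Fn_loop n) = mult F_loop"
        by (simp add: Fn_loop_def)
      then show ?thesis
        using subloopD(1)[OF sub] by (auto simp: hom_def intro!: g.F_hom_mult)
    qed
    have ext: "g.F_hom x = f x" if "x \<in> ?X" for x
      using that by (auto simp: g.F_hom_gen g_def)
    have "h' x = g.F_hom x"
      if "h' \<in> hom (Fn_loop n) L" "\<forall>x\<in>?X. h' x = f x" "x \<in> carrier (Fn_loop n)" for h' x
    proof (rule hom_agree_on_generated[OF Fn.alg_loop_axioms L.alg_loop_axioms XFn that(1) hom])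
      show "h' y = g.F_hom y" if "y \<in> ?X" for y
        using ext[OF that] \<open>\<forall>x\<in>?X. h' x = f x\<close> that by auto
      show "x \<in> subloop_generated (Fn_loop n) ?X"
        using that(3) gen by simp
    qed
    then show ?thesis
      using hom ext by blast
  qed
  then show "free_basis_E TYPE('b) (Fn_loop n) ?X"
    unfolding free_basis_E_def using E XFn gen by blast
qed
end
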